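(* Let $G$ be a compact group, let $Y$ be a metrizable $G$-space and let $X$ be a compact invariant subset of $Y$ containing more than one point. For every $\varepsilon>0$ there exists a linear positive continuous extension operator $T:C_{inv}(X\times X)\to C_{inv}(Y\times Y)$ with $\|T\|<1+\varepsilon$ which preserves the class of continuous invariant pseudometrics, the class of continuous invariant metrics, and the class of admissible invariant metrics. Moreover, if the group $G$ is finite, then the operator $T$ is (also) continuous with respect to the topologies of pointwise convergence of functions.
   Context: $G$ is a compact (Hausdorff) topological group; a $G$-space is a topological space with a continuous left action of $G$; a subset $X$ is invariant if $gx\in X$ for all $g\in G$, $x\in X$. For a $G$-space $Z$, $C(Z\times Z)$ is the vector lattice of continuous real-valued functions on $Z\times Z$ with the compact-open topology, and $C_{inv}(Z\times Z)=\{f\in C(Z\times Z): f(gx,gy)=f(x,y)\text{ for all }g\in G,\ x,y\in Z\}$ is its linear subspace of invariant functions. "Continuous" for $T$ refers to the compact-open topologies unless otherwise stated. $T$ is an extension operator if $T(p)|_{X\times X}=p$ for every $p$; it is positive if $p\ge 0$ implies $T(p)\ge 0$. For a function $f$, $\|f\|=\sup|f|\in[0,\infty]$, and $\|T\|=\inf\{M\in\mathbb{R}: \|T(p)\|\le M\|p\|\text{ for all }p\}$. $T$ preserves a class of functions if $T(p)$ belongs to the class (relative to $Y$) whenever $p\in C_{inv}(X\times X)$ belongs to the class (relative to $X$). A metric $d$ on a topological space $Z$ is admissible if it is continuous as a function on $Z\times Z$ and dominating, i.e. for every $z\in Z$ and every open neighborhood $U$ of $z$ there is $\varepsilon>0$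 with $\{z'\in Z: d(z,z')<\varepsilon\}\subset U$. *)

theory Defs
  imports "HOL-Analysis.Analysis" "HOL-Algebra.Group_Action"
begin

locale compact_topological_group = group G for G :: "('g, 'm) monoid_scheme" (structure) +
  fixes TG :: "'g topology"
  assumes topspace_TG: "topspace TG = carrier G"
    and continuous_mult: "continuous_map (prod_topology TG TG) TG (\<lambda>(g, h). g \<otimes> h)"
    and continuous_inv: "continuous_map TG TG (\<lambda>g. inv g)"
    and compact_TG: "compact_space TG"
    and Hausdorff_TG: "Hausdorff_space TG"

locale G_space = group_action G "topspace Z" \<phi>
  for G :: "('g, 'm) monoid_scheme" (structure) and TG :: "'g topology"
    and Z :: "'z topology" and \<phi> :: "'g \<Rightarrow> 'z \<Rightarrow> 'z" +
  assumes continuous_action: "continuous_map (prod_topology TG Z) Z (\<lambda>(g, z). \<phi> g z)"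

definition invariant_subset ::
    "('g, 'm) monoid_scheme \<Rightarrow> ('g \<Rightarrow> 'z \<Rightarrow> 'z) \<Rightarrow> 'z set \<Rightarrow> bool" where
  "invariant_subset G \<phi> X \<longleftrightarrow> (\<forall>g\<in>carrier G. \<forall>x\<in>X. \<phi> g x \<in> X)"

text \<open>A function on the carrier of a topology is represented by its extensional representative,
  so that equality of HOL functions is equality on the carrier.\<close>

definition cont_fun :: "'a topology \<Rightarrow> ('a \<Rightarrow> real) set" where
  "cont_fun A = {f \<in> extensional (topspace A). continuous_map A euclideanreal f}"

definition compact_open_topology :: "'a topology \<Rightarrow> ('a \<Rightarrow> real) topology" where
  "compact_open_topology A =
     topology_generated_by
       {{f \<in> cont_fun A. f ` K \<subseteq> U} | K U. compactin A K \<and> open U}"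

lemma topspace_compact_open_topology [simp]:
  "topspace (compact_open_topology A) = cont_fun A"
proof -
  have "cont_fun A \<in> {{f \<in> cont_fun A. f ` K \<subseteq> U} | K U. compactin A K \<and> open U}"
    by (rule CollectI, rule exI[of _ "{}"], rule exI[of _ UNIV]) auto
  then show ?thesis
    unfolding compact_open_topology_def topology_generated_by_topspace by blast
qed

definition C_inv ::
    "('g, 'm) monoid_scheme \<Rightarrow> ('g \<Rightarrow> 'z \<Rightarrow> 'z) \<Rightarrow> 'z topology \<Rightarrow> ('z \<times> 'z \<Rightarrow> real) set" where
  "C_inv G \<phi> Z = {f \<in> cont_fun (prod_topology Z Z).
     \<forall>g\<in>carrier G. \<forall>x\<in>topspace Z. \<forall>y\<in>topspace Z. f (\<phi> g x, \<phi> g y) = f (x, y)}"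

definition C_inv_compact_open ::
    "('g, 'm) monoid_scheme \<Rightarrow> ('g \<Rightarrow> 'z \<Rightarrow> 'z) \<Rightarrow> 'z topology \<Rightarrow> ('z \<times> 'z \<Rightarrow> real) topology" where
  "C_inv_compact_open G \<phi> Z =
     subtopology (compact_open_topology (prod_topology Z Z)) (C_inv G \<phi> Z)"

definition C_inv_pointwise ::
    "('g, 'm) monoid_scheme \<Rightarrow> ('g \<Rightarrow> 'z \<Rightarrow> 'z) \<Rightarrow> 'z topology \<Rightarrow> ('z \<times> 'z \<Rightarrow> real) topology" where
  "C_inv_pointwise G \<phi> Z =
     subtopology (product_topology (\<lambda>_. euclideanreal) (topspace Z \<times> topspace Z)) (C_inv G \<phi> Z)"

definition pseudometric_on :: "'z set \<Rightarrow> ('z \<times> 'z \<Rightarrow> real) \<Rightarrow> bool" where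
  "pseudometric_on S d \<longleftrightarrow>
     (\<forall>x\<in>S. \<forall>y\<in>S. 0 \<le> d (x, y)) \<and>
     (\<forall>x\<in>S. d (x, x) = 0) \<and>
     (\<forall>x\<in>S. \<forall>y\<in>S. d (x, y) = d (y, x)) \<and>
     (\<forall>x\<in>S. \<forall>y\<in>S. \<forall>z\<in>S. d (x, z) \<le> d (x, y) + d (y, z))"

definition metric_on :: "'z set \<Rightarrow> ('z \<times> 'z \<Rightarrow> real) \<Rightarrow> bool" where
  "metric_on S d \<longleftrightarrow>
     pseudometric_on S d \<and> (\<forall>x\<in>S. \<forall>y\<in>S. d (x, y) = 0 \<longrightarrow> x = y)"

text \<open>The locale \<^locale>\<open>Metric_space\<close> constrains the distance outside the carrier as well, hence
  the extension by zero here.\<close>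

lemma metric_on_iff_Metric_space:
  "metric_on S d \<longleftrightarrow> Metric_space S (\<lambda>x y. if x \<in> S \<and> y \<in> S then d (x, y) else 0)"
  unfolding metric_on_def pseudometric_on_def Metric_space_def by (auto 0 3)

definition dominating :: "'z topology \<Rightarrow> ('z \<times> 'z \<Rightarrow> real) \<Rightarrow> bool" where
  "dominating Z d \<longleftrightarrow>
     (\<forall>z U. openin Z U \<and> z \<in> U \<longrightarrow> (\<exists>\<epsilon>>0. {z' \<in> topspace Z. d (z, z') < \<epsilon>} \<subseteq> U))"

definition invariant_pseudometrics ::
    "('g, 'm) monoid_scheme \<Rightarrow> ('g \<Rightarrow> 'z \<Rightarrow> 'z) \<Rightarrow> 'z topology \<Rightarrow> ('z \<times> 'z \<Rightarrow> real) set" where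
  "invariant_pseudometrics G \<phi> Z = {d \<in> C_inv G \<phi> Z. pseudometric_on (topspace Z) d}"

definition invariant_metrics ::
    "('g, 'm) monoid_scheme \<Rightarrow> ('g \<Rightarrow> 'z \<Rightarrow> 'z) \<Rightarrow> 'z topology \<Rightarrow> ('z \<times> 'z \<Rightarrow> real) set" where
  "invariant_metrics G \<phi> Z = {d \<in> C_inv G \<phi> Z. metric_on (topspace Z) d}"

definition admissible_invariant_metrics ::
    "('g, 'm) monoid_scheme \<Rightarrow> ('g \<Rightarrow> 'z \<Rightarrow> 'z) \<Rightarrow> 'z topology \<Rightarrow> ('z \<times> 'z \<Rightarrow> real) set" where
  "admissible_invariant_metrics G \<phi> Z =
     {d \<in> C_inv G \<phi> Z. metric_on (topspace Z) d \<and> dominating Z d}"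

text \<open>The supremum is formed in \<^typ>\<open>ennreal\<close>, so it is 0 for an empty carrier; the values are
  moved to \<^typ>\<open>ereal\<close> because the bound in the operator norm is an arbitrary real number.\<close>

definition sup_norm :: "'a set \<Rightarrow> ('a \<Rightarrow> real) \<Rightarrow> ereal" where
  "sup_norm S f = enn2ereal (SUP s\<in>S. ennreal \<bar>f s\<bar>)"

text \<open>In the following, operators are considered from \<^term>\<open>C_inv G \<phi> X\<close> to \<^term>\<open>C_inv G \<phi> Y\<close>; their
  values at other arguments are irrelevant.\<close>

definition op_norm ::
    "('g, 'm) monoid_scheme \<Rightarrow> ('g \<Rightarrow> 'z \<Rightarrow> 'z) \<Rightarrow> 'z topology \<Rightarrow> 'z topology \<Rightarrow>
     (('z \<times> 'z \<Rightarrow> real) \<Rightarrow> 'z \<times> 'z \<Rightarrow> real) \<Rightarrow> ereal" where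
  "op_norm G \<phi> X Y T =
     Inf {ereal M | M. \<forall>p\<in>C_inv G \<phi> X.
       sup_norm (topspace Y \<times> topspace Y) (T p) \<le> ereal M * sup_norm (topspace X \<times> topspace X) p}"

definition linear_operator ::
    "('g, 'm) monoid_scheme \<Rightarrow> ('g \<Rightarrow> 'z \<Rightarrow> 'z) \<Rightarrow> 'z topology \<Rightarrow> 'z topology \<Rightarrow>
     (('z \<times> 'z \<Rightarrow> real) \<Rightarrow> 'z \<times> 'z \<Rightarrow> real) \<Rightarrow> bool" where
  "linear_operator G \<phi> X Y T \<longleftrightarrow>
     (\<forall>p\<in>C_inv G \<phi> X. \<forall>q\<in>C_inv G \<phi> X. \<forall>a b.
        T (\<lambda>z\<in>topspace X \<times> topspace X. a * p z + b * q z) =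
        (\<lambda>z\<in>topspace Y \<times> topspace Y. a * T p z + b * T q z))"

definition positive_operator ::
    "('g, 'm) monoid_scheme \<Rightarrow> ('g \<Rightarrow> 'z \<Rightarrow> 'z) \<Rightarrow> 'z topology \<Rightarrow> 'z topology \<Rightarrow>
     (('z \<times> 'z \<Rightarrow> real) \<Rightarrow> 'z \<times> 'z \<Rightarrow> real) \<Rightarrow> bool" where
  "positive_operator G \<phi> X Y T \<longleftrightarrow>
     (\<forall>p\<in>C_inv G \<phi> X. (\<forall>z\<in>topspace X \<times> topspace X. 0 \<le> p z) \<longrightarrow>
        (\<forall>z\<in>topspace Y \<times> topspace Y. 0 \<le> T p z))"

definition extension_operator ::
    "('g, 'm) monoid_scheme \<Rightarrow> ('g \<Rightarrow> 'z \<Rightarrow> 'z) \<Rightarrow> 'z topology \<Rightarrow> 'z topology \<Rightarrow>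
     (('z \<times> 'z \<Rightarrow> real) \<Rightarrow> 'z \<times> 'z \<Rightarrow> real) \<Rightarrow> bool" where
  "extension_operator G \<phi> X Y T \<longleftrightarrow>
     (\<forall>p\<in>C_inv G \<phi> X. T p \<in> C_inv G \<phi> Y \<and> restrict (T p) (topspace X \<times> topspace X) = p)"

end

theory Submission
  imports Defs "HOL-Probability.Probability_Measure"
begin

text \<open>
  Fix \<^term>\<open>a \<noteq> b\<close> in \<^term>\<open>X\<close>. The operator is
  \<open>T p (y, z) = M\<^sub>g (\<integral> p (r\<^sub>t (gy), r\<^sub>t (gz)) dt) + p (a, b) * \<rho> (y, z)\<close>, the integral over \<open>0 \<le> t \<le> 1\<close>.
  Here \<open>r\<^sub>t\<close> is a random retraction of \<open>Y\<close> onto \<open>X\<close>: no single \<open>r\<^sub>t\<close> is continuous, but the integral is.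
  Evaluating \<open>p\<close> along one common \<open>t\<close> keeps the diagonal at zero and preserves the triangle inequality.
  The invariant mean \<open>M\<close> on \<open>C(G)\<close> restores invariance and does not change the values on \<open>X\<close>.
  The pseudometric \<open>\<rho>\<close> is a small invariant admissible metric of \<open>Y\<close> with \<open>X\<close> collapsed to a point;
  it separates the points outside \<open>X\<close> and contributes at most \<open>\<epsilon>/2\<close> to the norm.
\<close>

section \<open>Real-valued maps on topological spaces\<close>

text \<open>A continuous retraction of \<open>Y\<close> onto \<open>X\<close> need not exist (take a
  circle in the plane), so \<open>p\<close> cannot simply be pulled back along one map.
  Discontinuous maps chosen at random keep linearity, positivity and the bound 1, and along each
  convergent sequence convergence fails only for a null set of parameters. The group average is
  applied to continuous functions of \<open>g\<close> only, so a positive normalised functional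
  invariant under right translations suffices. It is obtained by compactness from averages over
  finitely many left translates; for a finite group it is the plain average, which keeps every value
  of \<open>T p\<close> a finite combination of values of \<open>p\<close>. Pulling back may give
  distinct points outside \<open>X\<close> the same images, hence the summand with \<rho>. Its
  coefficient has to be linear and positive in \<open>p\<close>, bounded by the norm of
  \<open>p\<close>, and strictly positive when \<open>p\<close> is a metric. Evaluation at one pair
  of distinct points does all this, and this is where \<open>X\<close> having more than one point
  enters.\<close>

lemma continuous_map_real_iff:
  "continuous_map Z euclideanreal f \<longleftrightarrow>
    (\<forall>z\<in>topspace Z. \<forall>e>0. \<exists>U. openin Z U \<and> z \<in> U \<and> (\<forall>w\<in>U. \<bar>f w - f z\<bar> < e))"
proof -
  have "continuous_map Z (Met_TC.mtopology :: real topology) f \<longleftrightarrow>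
    (\<forall>z\<in>topspace Z. \<forall>e>0. \<exists>U. openin Z U \<and> z \<in> U \<and> (\<forall>w\<in>U. f w \<in> Met_TC.mball (f z) e))"
    by (rule Met_TC.continuous_map_to_metric)
  then show ?thesis by (simp add: dist_real_def abs_minus_commute)
qed

text \<open>The set where \<open>h (k, w)\<close> differs from \<open>h (k, z)\<close> by less than
  \<open>e\<close> is open and contains the slice over \<open>z\<close>, so the tube lemma applies.
  All estimates that are uniform in the group variable come from here.\<close>

lemma uniform_tube:
  assumes K: "compact_space K"
    and h: "continuous_map (prod_topology K Z) euclideanreal h"
    and z: "z \<in> topspace Z" and e: "e > 0"
  shows "\<exists>U. openin Z U \<and> z \<in> U \<and> (\<forall>w\<in>U. \<forall>k\<in>topspace K. \<bar>h (k, w) - h (k, z)\<bar> < e)"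
proof -
  have c2: "continuous_map (prod_topology K Z) euclideanreal (\<lambda>u. h (fst u, z))"
  proof -
    have "continuous_map (prod_topology K Z) (prod_topology K Z) (\<lambda>u. (fst u, z))"
      using z by (intro continuous_intros) (auto simp: continuous_map_fst)
    from continuous_map_compose[OF this h] show ?thesis by (simp add: o_def)
  qed
  have c3: "continuous_map (prod_topology K Z) euclideanreal (\<lambda>u. \<bar>h u - h (fst u, z)\<bar>)"
    by (intro continuous_intros h c2)
  define W where "W = {u \<in> topspace (prod_topology K Z). \<bar>h u - h (fst u, z)\<bar> \<in> {..<e}}"
  have W: "openin (prod_topology K Z) W"
    unfolding W_def by (rule openin_continuous_map_preimage[OF c3]) simp
  have "topspace K \<times> {z} \<subseteq> W" using z e by (auto simp: W_def)
  from tube_lemma_left[OF W _ z this] K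
  obtain U V where UV: "openin K U" "openin Z V" "topspace K \<subseteq> U" "z \<in> V" "U \<times> V \<subseteq> W"
    by (auto simp: compact_space_def)
  have "\<bar>h (k, w) - h (k, z)\<bar> < e" if "w \<in> V" "k \<in> topspace K" for w k
    using UV that by (force simp: W_def)
  with UV show ?thesis by blast
qed

text \<open>Dominated convergence speaks about sequences only; in a metrizable space they detect
  closed sets, hence continuity.\<close>

lemma continuous_map_real_sequentially:
  assumes Z: "metrizable_space Z"
    and f: "\<And>\<sigma> l. limitin Z \<sigma> l sequentially \<Longrightarrow> range \<sigma> \<subseteq> topspace Z \<Longrightarrow> (\<lambda>n. f (\<sigma> n)) \<longlonglongrightarrow> f l"
  shows "continuous_map Z euclideanreal f"
proof -
  obtain M d where "Metric_space M d" and Zeq: "Z = Metric_space.mtopology M d"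
    using Z unfolding metrizable_space_def by blast
  interpret Metric_space M d by fact
  have "closedin Z {z \<in> topspace Z. f z \<in> C}" if "closed C" for C
    unfolding Zeq metric_closedin_iff_sequentially_closed
  proof (intro conjI allI impI)
    fix \<sigma> l assume *: "range \<sigma> \<subseteq> {z \<in> topspace mtopology. f z \<in> C} \<and> limitin mtopology \<sigma> l sequentially"
    then have "(\<lambda>n. f (\<sigma> n)) \<longlonglongrightarrow> f l" by (intro f) (auto simp: Zeq)
    then have "f l \<in> C" using * \<open>closed C\<close> closed_sequentially[of C "\<lambda>n. f (\<sigma> n)"] by auto
    then show "l \<in> {z \<in> topspace mtopology. f z \<in> C}" using * limitin_mspace by auto
  qed auto
  then show ?thesis by (auto simp: continuous_map_closedin)
qed

section \<open>Invariant means on compact groups\<close>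

context compact_topological_group
begin

abbreviation CG :: "('g \<Rightarrow> real) set" where
  "CG \<equiv> {f. continuous_map TG euclideanreal f}"

text \<open>Averages of finitely many left translates have these properties, and the properties are closed
  under composition.\<close>

definition mean_operator :: "(('g \<Rightarrow> real) \<Rightarrow> 'g \<Rightarrow> real) \<Rightarrow> bool" where
  "mean_operator L \<longleftrightarrow>
    (\<forall>f g a b. \<forall>x\<in>carrier G. L (\<lambda>x. a * f x + b * g x) x = a * L f x + b * L g x) \<and>
    (\<forall>f. (\<forall>x\<in>carrier G. 0 \<le> f x) \<longrightarrow> (\<forall>x\<in>carrier G. 0 \<le> L f x)) \<and>
    (\<forall>x\<in>carrier G. L (\<lambda>_. 1) x = 1) \<and>
    (\<forall>f. \<forall>k\<in>carrier G. \<forall>x\<in>carrier G. L (\<lambda>x. f (x \<otimes> k)) x = L f (x \<otimes> k)) \<and>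
    (\<forall>f\<in>CG. L f \<in> CG)"

lemma mean_operatorD:
  assumes "mean_operator L"
  shows "x \<in> carrier G \<Longrightarrow> L (\<lambda>x. a * f x + b * g x) x = a * L f x + b * L g x"
    and "(\<And>x. x \<in> carrier G \<Longrightarrow> 0 \<le> f x) \<Longrightarrow> x \<in> carrier G \<Longrightarrow> 0 \<le> L f x"
    and "x \<in> carrier G \<Longrightarrow> L (\<lambda>_. 1) x = 1"
    and "k \<in> carrier G \<Longrightarrow> x \<in> carrier G \<Longrightarrow> L (\<lambda>x. f (x \<otimes> k)) x = L f (x \<otimes> k)"
    and "continuous_map TG euclideanreal f \<Longrightarrow> continuous_map TG euclideanreal (L f)"
proof -
  note L = assms[unfolded mean_operator_def]
  show "x \<in> carrier G \<Longrightarrow> L (\<lambda>x. a * f x + b * g x) x = a * L f x + b * L g x"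
    by (rule conjunct1[OF L, rule_format])
  show "(\<And>x. x \<in> carrier G \<Longrightarrow> 0 \<le> f x) \<Longrightarrow> x \<in> carrier G \<Longrightarrow> 0 \<le> L f x"
    using conjunct1[OF conjunct2[OF L]] by blast
  show "x \<in> carrier G \<Longrightarrow> L (\<lambda>_. 1) x = 1"
    using conjunct1[OF conjunct2[OF conjunct2[OF L]]] by blast
  show "k \<in> carrier G \<Longrightarrow> x \<in> carrier G \<Longrightarrow> L (\<lambda>x. f (x \<otimes> k)) x = L f (x \<otimes> k)"
    by (rule conjunct1[OF conjunct2[OF conjunct2[OF conjunct2[OF L]]], rule_format])
  show "continuous_map TG euclideanreal f \<Longrightarrow> continuous_map TG euclideanreal (L f)"
    using conjunct2[OF conjunct2[OF conjunct2[OF conjunct2[OF L]]]] by blast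
qed

text \<open>The slack \<open>c\<close> lets one statement serve for monotonicity, for dependence on
  the carrier values only, and for uniform estimates.\<close>

lemma mean_operator_mono:
  assumes L: "mean_operator L" and le: "\<And>x. x \<in> carrier G \<Longrightarrow> f x \<le> g x + c" and x: "x \<in> carrier G"
  shows "L f x \<le> L g x + c"
proof -
  have "0 \<le> L (\<lambda>x. 1 * (g x + c) + (-1) * f x) x"
    by (rule mean_operatorD(2)[OF L _ x]) (use le in auto)
  also have "\<dots> = L (\<lambda>x. 1 * g x + c * 1) x - L f x"
    using mean_operatorD(1)[OF L x, where f = "\<lambda>x. g x + c" and g=f and a=1 and b = "-1"] by simp
  also have "L (\<lambda>x. 1 * g x + c * 1) x = L g x + c"
    using mean_operatorD(1)[OF L x, where f = g and g="\<lambda>_. 1" and a=1 and b = c] mean_operatorD(3)[OF L x] by simp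
  finally show ?thesis by simp
qed

lemma mean_operator_const:
  assumes L: "mean_operator L" and x: "x \<in> carrier G"
  shows "L (\<lambda>_. c) x = c"
  using mean_operatorD(1)[OF L x, where f = "\<lambda>_. 1" and g="\<lambda>_. 1" and a=c and b = 0] mean_operatorD(3)[OF L x] by simp

lemma mean_operator_id: "mean_operator (\<lambda>f. f)"
  by (auto simp: mean_operator_def)

lemma mean_operator_compose:
  assumes L: "mean_operator L" and L': "mean_operator L'"
  shows "mean_operator (\<lambda>f. L (L' f))"
proof -
  \<comment> \<open>The properties of \<open>L'\<close> hold at points of the carrier only.
    Positivity shows that \<open>L\<close> does not see values elsewhere, so they may be used under
    \<open>L\<close>.\<close>
  have cong: "L f x = L g x" if "\<And>x. x \<in> carrier G \<Longrightarrow> f x = g x" "x \<in> carrier G" for f g x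
    using mean_operator_mono[OF L, of f g 0 x] mean_operator_mono[OF L, of g f 0 x] that by fastforce
  show ?thesis
    unfolding mean_operator_def
  proof (intro conjI allI ballI impI)
    fix f g :: "'g \<Rightarrow> real" and a b x assume x: "x \<in> carrier G"
    have "L (L' (\<lambda>x. a * f x + b * g x)) x = L (\<lambda>x. a * L' f x + b * L' g x) x"
      by (rule cong[OF _ x]) (rule mean_operatorD(1)[OF L'])
    then show "L (L' (\<lambda>x. a * f x + b * g x)) x = a * L (L' f) x + b * L (L' g) x"
      using mean_operatorD(1)[OF L x] by simp
  next
    fix f :: "'g \<Rightarrow> real" and k x assume k: "k \<in> carrier G" and x: "x \<in> carrier G"
    have "L (L' (\<lambda>x. f (x \<otimes> k))) x = L (\<lambda>x. L' f (x \<otimes> k)) x"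
      by (rule cong[OF _ x]) (rule mean_operatorD(4)[OF L' k])
    then show "L (L' (\<lambda>x. f (x \<otimes> k))) x = L (L' f) (x \<otimes> k)"
      using mean_operatorD(4)[OF L k x] by simp
  next
    fix x assume x: "x \<in> carrier G"
    have "L (L' (\<lambda>_. 1)) x = L (\<lambda>_. 1) x"
      by (rule cong[OF _ x]) (rule mean_operatorD(3)[OF L'])
    then show "L (L' (\<lambda>_. 1)) x = 1" using mean_operatorD(3)[OF L x] by simp
  qed (use mean_operatorD(2,5)[OF L] mean_operatorD(2,5)[OF L'] in auto)
qed

lemma continuous_left_translation:
  assumes f: "continuous_map TG Z f" and b: "b \<in> carrier G"
  shows "continuous_map TG Z (\<lambda>x. f (b \<otimes> x))"
proof -
  have "continuous_map TG (prod_topology TG TG) (\<lambda>x. (b, x))"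
    using b by (simp add: continuous_map_paired topspace_TG)
  from continuous_map_compose[OF continuous_map_compose[OF this continuous_mult] f]
  show ?thesis by (simp add: o_def)
qed

lemma continuous_right_translation:
  assumes f: "continuous_map TG Z f" and b: "b \<in> carrier G"
  shows "continuous_map TG Z (\<lambda>x. f (x \<otimes> b))"
proof -
  have "continuous_map TG (prod_topology TG TG) (\<lambda>x. (x, b))"
    using b by (simp add: continuous_map_paired topspace_TG)
  from continuous_map_compose[OF continuous_map_compose[OF this continuous_mult] f]
  show ?thesis by (simp add: o_def)
qed

text \<open>By associativity left translations commute with right ones, so averages of left
  translates are compatible with right translation.\<close>

lemma mean_operator_average:
  assumes C: "finite C" "C \<noteq> {}" and b: "\<And>c. c \<in> C \<Longrightarrow> b c \<in> carrier G"
  shows "mean_operator (\<lambda>f x. (\<Sum>c\<in>C. f (b c \<otimes> x)) / card C)"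
  unfolding mean_operator_def
proof (intro conjI allI ballI impI)
  fix f :: "'g \<Rightarrow> real" assume "f \<in> CG"
  then show "(\<lambda>x. (\<Sum>c\<in>C. f (b c \<otimes> x)) / card C) \<in> CG"
    using C b by (auto intro!: continuous_intros continuous_left_translation)
next
  fix f g :: "'g \<Rightarrow> real" and u v x
  show "(\<Sum>c\<in>C. u * f (b c \<otimes> x) + v * g (b c \<otimes> x)) / card C =
      u * ((\<Sum>c\<in>C. f (b c \<otimes> x)) / card C) + v * ((\<Sum>c\<in>C. g (b c \<otimes> x)) / card C)"
    by (simp add: sum.distrib sum_distrib_left add_divide_distrib)
next
  fix f :: "'g \<Rightarrow> real" and x assume "\<forall>x\<in>carrier G. 0 \<le> f x" "x \<in> carrier G"
  then show "0 \<le> (\<Sum>c\<in>C. f (b c \<otimes> x)) / card C"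
    using b by (intro divide_nonneg_nonneg sum_nonneg) auto
next
  fix f :: "'g \<Rightarrow> real" and k x assume "k \<in> carrier G" "x \<in> carrier G"
  then show "(\<Sum>c\<in>C. f (b c \<otimes> x \<otimes> k)) / card C = (\<Sum>c\<in>C. f (b c \<otimes> (x \<otimes> k))) / card C"
    using b by (simp add: m_assoc)
qed (use C in auto)

text \<open>The right translates of \<open>f\<close> form a totally bounded set in the sup norm:
  nearby points give uniformly close translates by \<open>uniform_tube\<close>, and finitely many
  such neighbourhoods cover the compact group.\<close>

lemma finite_net_of_translates:
  assumes f: "f \<in> CG" and e: "e > 0"
  shows "\<exists>C. finite C \<and> C \<noteq> {} \<and> C \<subseteq> carrier G \<and>
    (\<forall>x\<in>carrier G. \<exists>c\<in>C. \<forall>g\<in>carrier G. \<bar>f (g \<otimes> x) - f (g \<otimes> c)\<bar> < e)"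
proof -
  define h where "h = f \<circ> (\<lambda>(g, x). g \<otimes> x)"
  have h: "continuous_map (prod_topology TG TG) euclideanreal h"
    unfolding h_def using f continuous_mult by (intro continuous_map_compose) auto
  have "\<forall>c\<in>carrier G. \<exists>U. openin TG U \<and> c \<in> U \<and> (\<forall>x\<in>U. \<forall>g\<in>carrier G. \<bar>f (g \<otimes> x) - f (g \<otimes> c)\<bar> < e)"
    using uniform_tube[OF compact_TG h _ e] by (simp add: h_def topspace_TG)
  from bchoice[OF this] obtain U where U: "\<forall>c\<in>carrier G. openin TG (U c) \<and> c \<in> U c \<and>
      (\<forall>x\<in>U c. \<forall>g\<in>carrier G. \<bar>f (g \<otimes> x) - f (g \<otimes> c)\<bar> < e)" ..
  have "topspace TG \<subseteq> \<Union>(U ` carrier G)" using U topspace_TG by blast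
  moreover have "\<forall>V\<in>U ` carrier G. openin TG V" using U by blast
  ultimately obtain \<F> where F: "finite \<F>" "\<F> \<subseteq> U ` carrier G" "topspace TG \<subseteq> \<Union>\<F>"
    using compact_TG[unfolded compact_space_alt, rule_format, of "U ` carrier G"] by blast
  then obtain C where C: "C \<subseteq> carrier G" "finite C" "\<F> = U ` C"
    by (meson finite_subset_image)
  have "\<exists>c\<in>C. \<forall>g\<in>carrier G. \<bar>f (g \<otimes> x) - f (g \<otimes> c)\<bar> < e" if "x \<in> carrier G" for x
  proof -
    have "x \<in> \<Union>(U ` C)" using that F(3) unfolding C(3) topspace_TG by (rule rev_subsetD)
    then obtain c where c: "c \<in> C" "x \<in> U c" by (elim UN_E)
    have "c \<in> carrier G" using c C by (elim subsetD)
    then have "\<forall>x\<in>U c. \<forall>g\<in>carrier G. \<bar>f (g \<otimes> x) - f (g \<otimes> c)\<bar> < e" using U by simp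
    with c show ?thesis by (intro bexI[of _ c]) simp_all
  qed
  then show ?thesis using C one_closed by (intro exI[of _ C]) auto
qed

lemma CG_attains_inf:
  assumes F: "F \<in> CG"
  shows "\<exists>y\<in>carrier G. \<forall>x\<in>carrier G. F y \<le> F x"
proof -
  have "compact (F ` carrier G)"
    using F compact_TG image_compactin[of TG "topspace TG" euclideanreal F]
    by (simp add: compact_space_def topspace_TG)
  then show ?thesis
    using compact_attains_inf[of "F ` carrier G"] one_closed by fastforce
qed

lemma CG_bounded:
  assumes "f \<in> CG"
  shows "\<exists>B. \<forall>x\<in>carrier G. \<bar>f x\<bar> \<le> B"
proof -
  obtain y where y: "\<forall>x\<in>carrier G. f y \<le> f x" using CG_attains_inf[OF assms] by blast
  have "(\<lambda>x. - f x) \<in> CG" using assms by (auto intro!: continuous_intros)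
  then obtain z where z: "\<forall>x\<in>carrier G. - f z \<le> - f x" using CG_attains_inf by blast
  have "\<bar>f x\<bar> \<le> max \<bar>f y\<bar> \<bar>f z\<bar>" if "x \<in> carrier G" for x
    using y z that by (smt (verit))
  then show ?thesis by blast
qed

text \<open>One averaging step: translating the minimum of \<^term>\<open>L f\<close> to each of the finitely many points
  of a net contracts the oscillation by a factor that depends only on the net for \<^term>\<open>f\<close>.\<close>

lemma oscillation_contraction:
  fixes e r :: real
  assumes f: "f \<in> CG" and L: "mean_operator L" and C: "finite C" "C \<noteq> {}" "C \<subseteq> carrier G"
    and net: "\<And>x. x \<in> carrier G \<Longrightarrow> \<exists>c\<in>C. \<forall>g\<in>carrier G. \<bar>f (g \<otimes> x) - f (g \<otimes> c)\<bar> < e"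
    and r: "\<And>x y. x \<in> carrier G \<Longrightarrow> y \<in> carrier G \<Longrightarrow> L f x - L f y \<le> r"
  shows "\<exists>L'. mean_operator L' \<and> (\<forall>x\<in>carrier G. \<forall>y\<in>carrier G.
    real (card C) * (L' f x - L' f y) \<le> (real (card C) - 1) * r + e)"
proof -
  obtain y0 where y0: "y0 \<in> carrier G" and min: "\<And>x. x \<in> carrier G \<Longrightarrow> L f y0 \<le> L f x"
    using CG_attains_inf[of "L f"] mean_operatorD(5)[OF L] f by auto
  define b where "b c = y0 \<otimes> inv c" for c
  have b: "b c \<in> carrier G" if "c \<in> C" for c using that y0 C by (auto simp: b_def)
  define B where "B = (\<lambda>F x. (\<Sum>c\<in>C. F (b c \<otimes> x)) / real (card C) :: real)"
  have B: "mean_operator B" unfolding B_def by (rule mean_operator_average) (use C b in auto)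
  have n: "card C > 0" using C by (simp add: card_gt_0_iff)
  \<comment> \<open>The net belongs to \<open>f\<close>, but \<open>L\<close> commutes with right
    translations and is monotone, so the same net with the same \<open>e\<close> works for
    \<open>L f\<close>, whatever \<open>L\<close> is.\<close>
  have near: "L f (g \<otimes> x) \<le> L f (g \<otimes> c) + e"
    if *: "\<forall>g\<in>carrier G. \<bar>f (g \<otimes> x) - f (g \<otimes> c)\<bar> < e" and x: "x \<in> carrier G" "c \<in> carrier G" "g \<in> carrier G" for g x c
  proof -
    have "L (\<lambda>g. f (g \<otimes> x)) g \<le> L (\<lambda>g. f (g \<otimes> c)) g + e"
    proof (rule mean_operator_mono[OF L])
      fix g assume "g \<in> carrier G"
      then have "\<bar>f (g \<otimes> x) - f (g \<otimes> c)\<bar> < e" using * by blast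
      then show "f (g \<otimes> x) \<le> f (g \<otimes> c) + e" by linarith
    qed (fact x)
    then show ?thesis using mean_operatorD(4)[OF L] x by simp
  qed
  have "real (card C) * (B (L f) x - B (L f) y) \<le> (real (card C) - 1) * r + e" if x: "x \<in> carrier G" and y: "y \<in> carrier G" for x y
  proof -
    let ?m = "L f y0"
    have "(\<Sum>c\<in>C. ?m) \<le> (\<Sum>c\<in>C. L f (b c \<otimes> y))"
      by (rule sum_mono) (use b y min in auto)
    then have 1: "card C * ?m \<le> card C * B (L f) y" using n by (simp add: B_def)
    \<comment> \<open>Of the \<open>card C\<close> terms of the average at \<open>x\<close>, the one
      for \<open>c\<close> is at most \<open>?m + e\<close> and the others at most
      \<open>?m + r\<close>; all terms at \<open>y\<close> are at least \<open>?m\<close>.\<close>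
    obtain c where c: "c \<in> C" and near_c: "\<forall>g\<in>carrier G. \<bar>f (g \<otimes> x) - f (g \<otimes> c)\<bar> < e" using net[OF x] by blast
    have cG: "c \<in> carrier G" using c C by blast
    have "b c \<otimes> c = y0" using cG y0 by (simp add: b_def m_assoc)
    with near[OF near_c x cG b[OF c]] have 2: "L f (b c \<otimes> x) \<le> ?m + e" by simp
    have 3: "(\<Sum>c'\<in>C-{c}. L f (b c' \<otimes> x)) \<le> (\<Sum>c'\<in>C-{c}. ?m + r)"
    proof (rule sum_mono)
      fix c' assume "c' \<in> C - {c}"
      then show "L f (b c' \<otimes> x) \<le> ?m + r" using r[of "b c' \<otimes> x" y0] b x y0 by simp
    qed
    have "card C * B (L f) x = L f (b c \<otimes> x) + (\<Sum>c'\<in>C-{c}. L f (b c' \<otimes> x))"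
      using n C c by (simp add: B_def sum.remove[of C c])
    also have "\<dots> \<le> ?m + e + (real (card C) - 1) * (?m + r)"
      using 2 3 c C n by (simp add: of_nat_diff)
    also have "\<dots> = card C * ?m + (real (card C) - 1) * r + e" by (simp add: algebra_simps)
    finally show ?thesis using 1 unfolding right_diff_distrib by linarith
  qed
  then show ?thesis using mean_operator_compose[OF B L] by (intro exI[of _ "\<lambda>f. B (L f)"]) auto
qed

text \<open>Let \<open>s\<close> be the infimum of the oscillation bounds that means can achieve for
  \<open>f\<close>. The net size \<open>n\<close> does not change with the mean, so a contraction
  step gives \<open>n * s \<le> (n - 1) * r + e/2\<close> for every achievable \<open>r\<close>;
  letting \<open>r\<close> approach \<open>s\<close> yields \<open>s \<le> e/2\<close>.\<close>

lemma small_oscillation: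
  assumes f: "f \<in> CG" and e: "e > 0"
  shows "\<exists>L. mean_operator L \<and> (\<forall>x\<in>carrier G. \<forall>y\<in>carrier G. L f x - L f y \<le> e)"
proof -
  define S where "S = {r. 0 \<le> r \<and> (\<exists>L. mean_operator L \<and> (\<forall>x\<in>carrier G. \<forall>y\<in>carrier G. L f x - L f y \<le> r))}"
  obtain B where B: "\<And>x. x \<in> carrier G \<Longrightarrow> \<bar>f x\<bar> \<le> B" using CG_bounded[OF f] by blast
  have "f x - f y \<le> 2 * B" if "x \<in> carrier G" "y \<in> carrier G" for x y
    using B[of x] B[of y] that by linarith
  moreover have "0 \<le> 2 * B" using B[OF one_closed] by linarith
  ultimately have "2 * B \<in> S" unfolding S_def using mean_operator_id by blast
  then have ne: "S \<noteq> {}" by blast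
  have bdd: "bdd_below S" unfolding S_def by (auto simp: bdd_below_def)
  define s where "s = Inf S"
  obtain C where C: "finite C" "C \<noteq> {}" "C \<subseteq> carrier G" and
    net: "\<And>x. x \<in> carrier G \<Longrightarrow> \<exists>c\<in>C. \<forall>g\<in>carrier G. \<bar>f (g \<otimes> x) - f (g \<otimes> c)\<bar> < e/2"
    using finite_net_of_translates[OF f, of "e/2"] e by auto
  define n where "n = real (card C)"
  have n: "n \<ge> 1" using C by (simp add: n_def Suc_leI card_gt_0_iff)
  have step: "n * s \<le> (n - 1) * r + e/2" if "r \<in> S" for r
  proof -
    from that obtain L where L: "mean_operator L" "\<And>x y. x \<in> carrier G \<Longrightarrow> y \<in> carrier G \<Longrightarrow> L f x - L f y \<le> r"
      and r: "0 \<le> r" unfolding S_def by blast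
    from oscillation_contraction[OF f L(1) C net L(2)] obtain L' where L': "mean_operator L'"
      "\<And>x y. x \<in> carrier G \<Longrightarrow> y \<in> carrier G \<Longrightarrow> n * (L' f x - L' f y) \<le> (n - 1) * r + e/2"
      unfolding n_def by blast
    have "((n - 1) * r + e/2) / n \<in> S"
      unfolding S_def
    proof (intro CollectI conjI exI[of _ L'] ballI)
      show "0 \<le> ((n - 1) * r + e/2) / n" using n r e by (intro divide_nonneg_nonneg add_nonneg_nonneg mult_nonneg_nonneg) auto
      show "L' f x - L' f y \<le> ((n - 1) * r + e/2) / n" if "x \<in> carrier G" "y \<in> carrier G" for x y
        using L'(2)[OF that] n by (simp add: pos_le_divide_eq mult.commute)
    qed (fact L'(1))
    then have "s \<le> ((n - 1) * r + e/2) / n" unfolding s_def using bdd by (rule cInf_lower)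
    then show ?thesis using n by (simp add: field_simps)
  qed
  have "s \<le> e/2"
  proof (rule ccontr)
    assume "\<not> s \<le> e/2"
    \<comment> \<open>With \<open>r\<close> this close to \<open>s\<close>, the inequality
      \<open>step\<close> would give \<open>s - e/2 \<le> (1 - 1/n) * (s - e/2)\<close>, impossible
      for a positive difference.\<close>
    then have "s < s + (s - e/2) / n" using n by simp
    then obtain r where r: "r \<in> S" "r < s + (s - e/2) / n"
      using cInf_lessD[OF ne, of "s + (s - e/2) / n"] by (auto simp: s_def)
    have "(n - 1) * r \<le> (n - 1) * (s + (s - e/2) / n)" using r n by (intro mult_left_mono) auto
    with step[OF r(1)] have "n * s \<le> (n - 1) * (s + (s - e/2) / n) + e/2" by linarith
    then have "(s - e/2) \<le> (n - 1) * ((s - e/2) / n)" by (simp add: algebra_simps)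
    also have "\<dots> = (s - e/2) - (s - e/2) / n" using n by (simp add: field_simps)
    finally show False using \<open>\<not> s \<le> e/2\<close> n by (auto simp: divide_le_0_iff)
  qed
  then have "\<exists>r\<in>S. r < e" using cInf_lessD[OF ne, of e] e by (auto simp: s_def)
  then show ?thesis unfolding S_def by fastforce
qed

text \<open>Applying a further mean never increases oscillation: the values at \<open>x\<close> and
  \<open>y\<close> are values at \<one> for two right translates of \<open>F\<close>, which differ
  by at most \<open>e\<close> everywhere.\<close>

lemma mean_operator_oscillation:
  assumes L: "mean_operator L"
    and e: "\<And>x y. x \<in> carrier G \<Longrightarrow> y \<in> carrier G \<Longrightarrow> F x - F y \<le> e"
    and x: "x \<in> carrier G" and y: "y \<in> carrier G"
  shows "L F x - L F y \<le> e"
proof -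
  have "L (\<lambda>g. F (g \<otimes> x)) \<one> \<le> L (\<lambda>g. F (g \<otimes> y)) \<one> + e"
    by (rule mean_operator_mono[OF L]) (use e x y in \<open>auto simp: algebra_simps\<close>)
  then show ?thesis using mean_operatorD(4)[OF L] x y by simp
qed

text \<open>Functions are treated one at a time: the new mean is chosen for \<open>L f\<close>
  rather than \<open>f\<close>, and composing with it spoils nothing achieved before.\<close>

lemma common_small_oscillation:
  assumes "finite \<F>" "\<F> \<subseteq> CG" and e: "e > 0"
  shows "\<exists>L. mean_operator L \<and> (\<forall>f\<in>\<F>. \<forall>x\<in>carrier G. \<forall>y\<in>carrier G. L f x - L f y \<le> e)"
  using assms(1,2)
proof induction
  case empty then show ?case using mean_operator_id by blast
next
  case (insert f \<F>)
  then obtain L where L: "mean_operator L" "\<forall>f\<in>\<F>. \<forall>x\<in>carrier G. \<forall>y\<in>carrier G. L f x - L f y \<le> e" by auto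
  have "L f \<in> CG" using insert L mean_operatorD(5)[OF L(1)] by auto
  from small_oscillation[OF this e] obtain L' where L': "mean_operator L'"
    "\<forall>x\<in>carrier G. \<forall>y\<in>carrier G. L' (L f) x - L' (L f) y \<le> e" by blast
  show ?case
    by (rule exI[of _ "\<lambda>f. L' (L f)"])
      (use L L' mean_operator_compose[OF L'(1) L(1)] mean_operator_oscillation[OF L'(1)] in auto)
qed

section \<open>Invariant means from approximately invariant ones\<close>

definition invariant_mean :: "(('g \<Rightarrow> real) \<Rightarrow> real) \<Rightarrow> bool" where
  "invariant_mean M \<longleftrightarrow>
    (\<forall>f\<in>CG. \<forall>g\<in>CG. \<forall>a b. M (\<lambda>x. a * f x + b * g x) = a * M f + b * M g) \<and>
    (\<forall>f\<in>CG. (\<forall>x\<in>carrier G. 0 \<le> f x) \<longrightarrow> 0 \<le> M f) \<and>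
    M (\<lambda>_. 1) = 1 \<and>
    (\<forall>f\<in>CG. \<forall>k\<in>carrier G. M (\<lambda>x. f (x \<otimes> k)) = M f)"

text \<open>Positive normalised functionals with prescribed bounds form a compact set in a product
  of intervals. Each finite family of approximate invariance conditions is met by evaluating a mean
  of small oscillation at \<one>, so all of them can be met at once.\<close>

lemma invariant_mean_exists: "\<exists>M. invariant_mean M"
proof -
  \<comment> \<open>The product is indexed by all functions; the value 0 off \<open>CG\<close>
    forces the functionals to vanish there and keeps every factor a compact interval.\<close>
  define N where "N f = (if f \<in> CG then (SOME B. \<forall>x\<in>carrier G. \<bar>f x\<bar> \<le> B) else 0)" for f
  have N: "\<bar>f x\<bar> \<le> N f" if "f \<in> CG" "x \<in> carrier G" for f x
    using someI_ex[OF CG_bounded[OF that(1)]] that unfolding N_def by auto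
  define lin where "lin f g a b = {m. m (\<lambda>x. a * f x + b * g x) = a * m f + b * m g}"
    for f g :: "'g \<Rightarrow> real" and a b :: real
  define K where "K = (\<Pi>\<^sub>E f\<in>UNIV. {- N f..N f}) \<inter> (\<Inter>f\<in>CG. \<Inter>g\<in>CG. \<Inter>a. \<Inter>b. lin f g a b)
     \<inter> (\<Inter>f\<in>{f\<in>CG. \<forall>x\<in>carrier G. 0 \<le> f x}. {m. 0 \<le> m f}) \<inter> {m. m (\<lambda>_. 1) = 1}"
  \<comment> \<open>Finite families are realised only up to a tolerance. As \<open>e\<close> runs
    over all positive reals, the common point is exactly invariant.\<close>
  define Inv where "Inv = (\<lambda>(f, k, e). {m :: ('g \<Rightarrow> real) \<Rightarrow> real. m (\<lambda>x. f (x \<otimes> k)) - m f \<le> e \<and> m f - m (\<lambda>x. f (x \<otimes> k)) \<le> e})"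
  let ?I = "CG \<times> carrier G \<times> {e::real. e > 0}"
  have "compactin (product_topology (\<lambda>_. euclideanreal) UNIV) (\<Pi>\<^sub>E f\<in>UNIV. {- N f..N f})"
    unfolding compactin_PiE by simp
  then have "compact (\<Pi>\<^sub>E f\<in>UNIV. {- N f..N f})"
    by (simp add: euclidean_product_topology)
  then have K: "compact K"
    unfolding K_def lin_def
    by (intro compact_Int_closed closed_INT ballI closed_Collect_eq closed_Collect_le
        continuous_intros continuous_on_product_coordinates)
  have closed: "closed (Inv i)" for i
    unfolding Inv_def by (cases i) (auto intro!: closed_Collect_conj closed_Collect_le
        continuous_intros continuous_on_product_coordinates)
  have "K \<inter> (\<Inter>i\<in>?I. Inv i) \<noteq> {}"
  proof (rule compact_imp_fip_image[OF K closed])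
    fix I' assume I': "finite I'" "I' \<subseteq> ?I"
    have fin: "finite (fst ` I')" "fst ` I' \<subseteq> CG" using I' by auto
    \<comment> \<open>The smallest tolerance requested; the 1 covers the empty family.\<close>
    define e where "e = Min (insert 1 ((\<lambda>i. snd (snd i)) ` I'))"
    have e: "e > 0" using I' by (auto simp: e_def)
    have e_le: "e \<le> snd (snd i)" if "i \<in> I'" for i using that I' by (auto simp: e_def)
    obtain L where L: "mean_operator L"
      "\<And>f x y. f \<in> fst ` I' \<Longrightarrow> x \<in> carrier G \<Longrightarrow> y \<in> carrier G \<Longrightarrow> L f x - L f y \<le> e"
      using common_small_oscillation[OF fin e] by blast
    \<comment> \<open>Right translation by \<open>k\<close> turns the value of \<open>L f\<close> at
      \<one> into its value at \<open>k\<close>, so small oscillation of \<open>L f\<close> is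
      approximate invariance of \<open>m\<close>.\<close>
    define m where "m f = (if f \<in> CG then L f \<one> else 0)" for f
    have CGlin: "(\<lambda>x. a * f x + b * g x) \<in> CG" if "f \<in> CG" "g \<in> CG" for f g a b
      using that by (auto intro!: continuous_intros)
    have "\<bar>m f\<bar> \<le> N f" for f
    proof (cases "f \<in> CG")
      case True
      have "L f \<one> \<le> L (\<lambda>_. N f) \<one> + 0"
        by (rule mean_operator_mono[OF L(1)]) (use N[OF True] in \<open>auto simp: abs_le_iff\<close>)
      moreover have "L (\<lambda>_. - N f) \<one> \<le> L f \<one> + 0"
        by (rule mean_operator_mono[OF L(1)]) (use N[OF True] in \<open>auto simp: abs_le_iff minus_le_iff\<close>)
      ultimately show ?thesis using True mean_operator_const[OF L(1) one_closed] by (auto simp: m_def)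
    qed (simp add: m_def N_def)
    then have "m \<in> (\<Pi>\<^sub>E f\<in>UNIV. {- N f..N f})" by (auto simp: abs_le_iff minus_le_iff)
    moreover have "m \<in> lin f g a b" if "f \<in> CG" "g \<in> CG" for f g a b
      using that CGlin[OF that] mean_operatorD(1)[OF L(1) one_closed] by (simp add: lin_def m_def)
    ultimately have "m \<in> K"
      using mean_operatorD(2,3)[OF L(1)] by (auto simp: K_def m_def)
    moreover have "m \<in> Inv i" if "i \<in> I'" for i
    proof -
      obtain f k e' where i: "i = (f, k, e')" by (cases i)
      with that I' have f: "f \<in> CG" "k \<in> carrier G" "f \<in> fst ` I'" by force+
      have "(\<lambda>x. f (x \<otimes> k)) \<in> CG" using f continuous_right_translation by auto
      moreover have "L (\<lambda>x. f (x \<otimes> k)) \<one> = L f k" using mean_operatorD(4)[OF L(1)] f by simp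
      ultimately show ?thesis
        using L(2)[OF f(3) f(2) one_closed] L(2)[OF f(3) one_closed f(2)] e_le[OF that] f
        by (simp add: Inv_def i m_def)
    qed
    ultimately show "K \<inter> (\<Inter>i\<in>I'. Inv i) \<noteq> {}" by blast
  qed
  then obtain M where M: "M \<in> K" "\<And>i. i \<in> ?I \<Longrightarrow> M \<in> Inv i" by blast
  have "M (\<lambda>x. f (x \<otimes> k)) = M f" if "f \<in> CG" "k \<in> carrier G" for f k
  proof (rule antisym)
    show "M (\<lambda>x. f (x \<otimes> k)) \<le> M f"
      by (rule field_le_epsilon) (use M(2)[of "(f, k, _)"] that in \<open>auto simp: Inv_def algebra_simps\<close>)
    show "M f \<le> M (\<lambda>x. f (x \<otimes> k))"
      by (rule field_le_epsilon) (use M(2)[of "(f, k, _)"] that in \<open>auto simp: Inv_def algebra_simps\<close>)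
  qed
  then have "invariant_mean M"
    using M(1) unfolding invariant_mean_def K_def lin_def by auto
  then show ?thesis by blast
qed

text \<open>Right translation permutes the carrier. The explicit sum is what makes the operator
  continuous for pointwise convergence.\<close>

lemma invariant_mean_finite:
  assumes fin: "finite (carrier G)"
  shows "invariant_mean (\<lambda>f. (\<Sum>x\<in>carrier G. f x) / card (carrier G))"
proof -
  have "card (carrier G) > 0" using fin one_closed by (auto simp: card_gt_0_iff)
  moreover have "(\<Sum>x\<in>carrier G. f (x \<otimes> k)) = (\<Sum>x\<in>carrier G. f x)" if k: "k \<in> carrier G" for f :: "'g \<Rightarrow> real" and k
  proof (rule sum.reindex_bij_witness[where i = "\<lambda>x. x \<otimes> inv k" and j = "\<lambda>x. x \<otimes> k"])
  qed (use k in \<open>auto simp: m_assoc\<close>)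
  ultimately show ?thesis
    unfolding invariant_mean_def
    by (auto simp: sum.distrib sum_distrib_left add_divide_distrib intro!: divide_nonneg_nonneg sum_nonneg)
qed

end

section \<open>Random retractions onto compact sets\<close>

lemma eventually_less_of_tendsto:
  fixes a b :: real
  assumes f: "(f \<longlongrightarrow> a) F" and g: "(g \<longlongrightarrow> b) F" and ab: "a < b"
  shows "\<forall>\<^sub>F n in F. f n < g n"
proof -
  obtain c where c: "a < c" "c < b" using dense[OF ab] by blast
  from order_tendstoD(2)[OF f c(1)] order_tendstoD(1)[OF g c(2)]
  show ?thesis by eventually_elim simp
qed

context Metric_space
begin

section \<open>The distance to a set and random retractions\<close>

definition mdist_set :: "'a set \<Rightarrow> 'a \<Rightarrow> real" where
  "mdist_set S y = (INF x\<in>S. d y x)"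

lemma mdist_set_le: "x \<in> S \<Longrightarrow> mdist_set S y \<le> d y x"
  unfolding mdist_set_def by (rule cINF_lower) (auto intro!: bdd_belowI[of _ 0])

lemma mdist_set_nonneg: "S \<noteq> {} \<Longrightarrow> 0 \<le> mdist_set S y"
  unfolding mdist_set_def by (rule cINF_greatest) auto

lemma mdist_set_triangle:
  assumes S: "S \<noteq> {}" "S \<subseteq> M" and "y \<in> M" "z \<in> M"
  shows "mdist_set S y \<le> d y z + mdist_set S z"
proof -
  have "mdist_set S y - d y z \<le> mdist_set S z"
    unfolding mdist_set_def[of S z]
  proof (rule cINF_greatest[OF S(1)])
    fix x assume "x \<in> S"
    then show "mdist_set S y - d y z \<le> d z x"
      using mdist_set_le[of x S y] triangle[of y z x] assms by auto
  qed
  then show ?thesis by simp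
qed

lemma mdist_set_eq_0_iff:
  assumes S: "S \<noteq> {}" "closedin mtopology S" and y: "y \<in> M"
  shows "mdist_set S y = 0 \<longleftrightarrow> y \<in> S"
proof
  assume 0: "mdist_set S y = 0"
  show "y \<in> S"
  proof (rule ccontr)
    assume "y \<notin> S"
    then obtain r where r: "r > 0" "disjnt S (mball y r)" using S y by (auto simp: closedin_metric)
    have "r \<le> mdist_set S y"
      unfolding mdist_set_def
    proof (rule cINF_greatest[OF S(1)])
      fix x assume "x \<in> S"
      moreover have "S \<subseteq> M" using S closedin_metric by blast
      ultimately show "r \<le> d y x" using r y by (force simp: disjnt_def)
    qed
    with 0 r show False by simp
  qed
next
  assume "y \<in> S"
  then show "mdist_set S y = 0"
    using mdist_set_le[of y S y] mdist_set_nonneg[OF S(1), of y] y by simp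
qed

lemma mdist_set_tendsto:
  assumes S: "S \<noteq> {}" "S \<subseteq> M" and \<sigma>: "limitin mtopology \<sigma> y sequentially" "range \<sigma> \<subseteq> M"
  shows "(\<lambda>n. mdist_set S (\<sigma> n)) \<longlonglongrightarrow> mdist_set S y"
proof -
  have y: "y \<in> M" and 0: "(\<lambda>n. d (\<sigma> n) y) \<longlonglongrightarrow> 0"
    using \<sigma> by (auto simp: limitin_metric_dist_null)
  have "\<bar>mdist_set S (\<sigma> n) - mdist_set S y\<bar> \<le> d (\<sigma> n) y" for n
    using mdist_set_triangle[OF S, of "\<sigma> n" y] mdist_set_triangle[OF S, of y "\<sigma> n"] y range_subsetD[OF \<sigma>(2), of n]
    by (auto simp: commute abs_le_iff)
  then have "(\<lambda>n. mdist_set S (\<sigma> n) - mdist_set S y) \<longlonglongrightarrow> 0"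
    by (intro tendsto_0_le[OF 0, of _ 1]) (auto intro: always_eventually)
  then show ?thesis by (simp add: LIM_zero_iff)
qed

text \<open>Finite nets for the radii \<open>1/(n+1)\<close> have a countable union. It is
  enumerated because the retraction selects the first suitable index.\<close>

lemma compactin_dense_sequence:
  assumes S: "compactin mtopology S" "S \<noteq> {}"
  shows "\<exists>x :: nat \<Rightarrow> 'a. range x \<subseteq> S \<and> (\<forall>y\<in>S. \<forall>e>0. \<exists>i. d y (x i) < e)"
proof -
  have "\<forall>n. \<exists>K. finite K \<and> K \<subseteq> S \<and> S \<subseteq> (\<Union>x\<in>K. mball x (inverse (real (Suc n))))"
    using compactin_imp_mtotally_bounded[OF S(1)] unfolding mtotally_bounded_def by simp
  then obtain K where K: "\<And>n. finite (K n)" "\<And>n. K n \<subseteq> S"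
    "\<And>n. S \<subseteq> (\<Union>x\<in>K n. mball x (inverse (real (Suc n))))" by metis
  define x where "x = from_nat_into (\<Union>n. K n)"
  have cnt: "countable (\<Union>n. K n)" using K(1) by (simp add: countable_finite)
  have ne: "(\<Union>n. K n) \<noteq> {}" using S(2) K(3)[of 0] by auto
  have rng: "range x = (\<Union>n. K n)" unfolding x_def using range_from_nat_into[OF ne cnt] .
  show ?thesis
  proof (intro exI[of _ x] conjI ballI allI impI)
    show "range x \<subseteq> S" using rng K(2) by auto
    fix y e assume y: "y \<in> S" and e: "(e::real) > 0"
    obtain n where n: "inverse (real (Suc n)) < e" using reals_Archimedean[OF e] by blast
    obtain z where z: "z \<in> K n" "d z y < inverse (real (Suc n))" using subsetD[OF K(3)[of n] y] by auto
    then have "z \<in> range x" unfolding rng by blast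
    then obtain i where i: "z = x i" by (rule rangeE)
    have "d y (x i) < e" using z n by (simp add: commute i)
    then show "\<exists>i. d y (x i) < e" ..
  qed
qed

text \<open>The point \<open>y\<close> outside \<open>S\<close> is sent to the first point of a dense sequence in \<open>S\<close> whose distance
  from \<open>y\<close> is less than \<open>2 + \<bar>t\<bar>\<close> times the distance of \<open>y\<close> from \<open>S\<close>. This is locally constant at \<open>y\<close>
  unless \<open>t\<close> belongs to a countable set depending on \<open>y\<close>.\<close>

lemma random_retraction:
  assumes S: "compactin mtopology S" "S \<noteq> {}"
  shows "\<exists>r :: real \<Rightarrow> 'a \<Rightarrow> 'a.
    (\<forall>t y. r t y \<in> S) \<and> (\<forall>t. \<forall>x\<in>S. r t x = x) \<and>
    (\<forall>y\<in>M. simple_function borel (\<lambda>t. r t y)) \<and>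
    (\<forall>\<sigma> y. limitin mtopology \<sigma> y sequentially \<longrightarrow> range \<sigma> \<subseteq> M \<longrightarrow>
      (AE t in lborel. limitin mtopology (\<lambda>n. r t (\<sigma> n)) (r t y) sequentially))"
proof -
  have SM: "S \<subseteq> M" using compactin_subset_topspace[OF S(1)] by simp
  have clS: "closedin mtopology S" using compactin_imp_closedin[OF Hausdorff_space_mtopology S(1)] .
  let ?\<delta> = "mdist_set S"
  from compactin_dense_sequence[OF S] obtain x :: "nat \<Rightarrow> 'a" where
    x_dense: "range x \<subseteq> S \<and> (\<forall>y\<in>S. \<forall>e>0. \<exists>i. d y (x i) < e)" ..
  then have x: "range x \<subseteq> S" ..
  have dense: "\<exists>i. d y (x i) < e" if "y \<in> S" "e > 0" for y e using x_dense that by blast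
  have xM: "x i \<in> M" for i using x SM by auto
  define P where "P t y i \<longleftrightarrow> d y (x i) < (2 + \<bar>t\<bar>) * ?\<delta> y" for t y i
  define i where "i t y = (LEAST i. P t y i)" for t y
  define r where "r t y = (if y \<in> S then y else x (i t y))" for t y
  have pos: "0 < ?\<delta> y" if "y \<in> M" "y \<notin> S" for y
    using that mdist_set_nonneg[OF S(2), of y] mdist_set_eq_0_iff[OF S(2) clS, of y] by auto
  have ex: "\<exists>i. P 0 y i" if y: "y \<in> M" "y \<notin> S" for y
  proof -
    \<comment> \<open>A point of \<open>S\<close> within 3/2 of the distance and a sequence member
      within 1/2 of it add up to the factor 2 that \<open>P\<close> allows at
      \<open>t = 0\<close>.\<close>
    have "?\<delta> y < 3/2 * ?\<delta> y" using pos[OF y] by simp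
    then have "Inf ((\<lambda>x. d y x) ` S) < 3/2 * ?\<delta> y" by (simp only: mdist_set_def)
    from cInf_lessD[OF _ this] obtain z where z: "z \<in> S" "d y z < 3/2 * ?\<delta> y" using S(2) by blast
    obtain j where j: "d z (x j) < 1/2 * ?\<delta> y" using dense[OF z(1), of "1/2 * ?\<delta> y"] pos[OF y] by auto
    have "d y (x j) \<le> d y z + d z (x j)" using triangle z SM y xM by auto
    then have "P 0 y j" using z j by (simp add: P_def)
    then show ?thesis ..
  qed
  have mono: "P t y i" if "P 0 y i" for t y i
  proof -
    have "2 * ?\<delta> y \<le> (2 + \<bar>t\<bar>) * ?\<delta> y"
      using mdist_set_nonneg[OF S(2), of y] by (intro mult_right_mono) auto
    then show ?thesis using that by (simp add: P_def)
  qed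
  have Pi: "P t y (i t y)" if y: "y \<in> M" "y \<notin> S" for t y
  proof -
    obtain j where "P 0 y j" using ex[OF y] ..
    from mono[OF this] show ?thesis unfolding i_def by (rule LeastI)
  qed
  \<comment> \<open>For limits in \<open>S\<close> this bound forces convergence for every
    \<open>t\<close>, since the distance to \<open>S\<close> tends to 0.\<close>
  have r_dist: "d (r t y) y \<le> (2 + \<bar>t\<bar>) * ?\<delta> y" if "y \<in> M" for t y
    using Pi[OF that, of t] that mdist_set_nonneg[OF S(2), of y]
    by (auto simp: r_def P_def commute)
  show ?thesis
  proof (intro exI[of _ r] conjI allI ballI impI)
    show "r t y \<in> S" for t y using x by (auto simp: r_def)
    show "r t y = y" if "y \<in> S" for t y using that by (simp add: r_def)
    show "simple_function borel (\<lambda>t. r t y)" if y: "y \<in> M" for y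
    proof (cases "y \<in> S")
      case True then show ?thesis by (simp add: r_def)
    next
      case False
      have meas: "(\<lambda>t. i t y) \<in> measurable borel (count_space UNIV)"
        unfolding i_def P_def by measurable
      \<comment> \<open>A witness for \<open>t = 0\<close> is one for all \<open>t\<close>, so the
        first index is bounded by \<open>j\<close> and takes finitely many values.\<close>
      obtain j where j: "P 0 y j" using ex[OF y False] by blast
      have "i t y \<le> j" for t unfolding i_def using mono[OF j] by (rule Least_le)
      then have "range (\<lambda>t. i t y) \<subseteq> {..j}" by auto
      then have "finite (range (\<lambda>t. i t y))" by (rule finite_subset) simp
      then have "simple_function borel (\<lambda>t. i t y)"
        unfolding simple_function_def using measurable_sets[OF meas] by auto
      then have "simple_function borel (x \<circ> (\<lambda>t. i t y))" by (rule simple_function_compose)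
      then show ?thesis using False by (simp add: r_def o_def)
    qed
    show "AE t in lborel. limitin mtopology (\<lambda>n. r t (\<sigma> n)) (r t y) sequentially"
      if \<sigma>: "limitin mtopology \<sigma> y sequentially" "range \<sigma> \<subseteq> M" for \<sigma> y
    proof -
      have y: "y \<in> M" and 0: "(\<lambda>n. d (\<sigma> n) y) \<longlonglongrightarrow> 0"
        using \<sigma> by (auto simp: limitin_metric_dist_null)
      have \<delta>: "(\<lambda>n. ?\<delta> (\<sigma> n)) \<longlonglongrightarrow> ?\<delta> y" by (rule mdist_set_tendsto[OF S(2) SM \<sigma>])
      show ?thesis
      proof (cases "y \<in> S")
        case True
        have "limitin mtopology (\<lambda>n. r t (\<sigma> n)) (r t y) sequentially" for t
        proof -
          have "?\<delta> y = 0" using True y mdist_set_eq_0_iff[OF S(2) clS] by simp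
          then have lim: "(\<lambda>n. (2 + \<bar>t\<bar>) * ?\<delta> (\<sigma> n) + d (\<sigma> n) y) \<longlonglongrightarrow> 0"
            using tendsto_add[OF tendsto_mult_left[OF \<delta>, of "2 + \<bar>t\<bar>"] 0] by simp
          have rM: "r t z \<in> M" for z using x SM by (auto simp: r_def)
          have "d (r t (\<sigma> n)) y \<le> (2 + \<bar>t\<bar>) * ?\<delta> (\<sigma> n) + d (\<sigma> n) y" for n
            using triangle[of "r t (\<sigma> n)" "\<sigma> n" y] r_dist[of "\<sigma> n" t] rM y \<sigma>(2) by force
          then have "(\<lambda>n. d (r t (\<sigma> n)) y) \<longlonglongrightarrow> 0"
            by (intro tendsto_sandwich[OF _ _ tendsto_const lim]) auto
          then show ?thesis using True rM y by (simp add: limitin_metric_dist_null r_def)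
        qed
        then show ?thesis by simp
      next
        case False
        \<comment> \<open>The parameters for which some comparison in \<open>P\<close> is an
          equality. As the distance from \<open>y\<close> to \<open>S\<close> is positive, each
          \<open>j\<close> contributes at most two values of \<open>t\<close>.\<close>
        define N where "N = (\<Union>j. {t. d y (x j) = (2 + \<bar>t\<bar>) * ?\<delta> y})"
        have N_sub: "{t. d y (x j) = (2 + \<bar>t\<bar>) * ?\<delta> y} \<subseteq> {d y (x j) / ?\<delta> y - 2, 2 - d y (x j) / ?\<delta> y}" for j
          using pos[OF y False] by (auto simp: field_simps abs_if split: if_splits)
        then have "countable N" unfolding N_def by (intro countable_UN countable_subset[OF N_sub]) auto
        then have "AE t in lborel. t \<notin> N" by (intro AE_not_in countable_imp_null_set_lborel)
        then show ?thesis
        proof (rule AE_mp, intro AE_I2 impI)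
          fix t assume t: "t \<notin> N"
          let ?k = "i t y"
          have dl: "(\<lambda>n. d (\<sigma> n) (x j)) \<longlonglongrightarrow> d y (x j)" for j
            using mdist_set_tendsto[of "{x j}", OF _ _ \<sigma>] xM by (simp add: mdist_set_def)
          have rl: "(\<lambda>n. (2 + \<bar>t\<bar>) * ?\<delta> (\<sigma> n)) \<longlonglongrightarrow> (2 + \<bar>t\<bar>) * ?\<delta> y"
            by (rule tendsto_mult_left[OF \<delta>])
          have "\<forall>\<^sub>F n in sequentially. P t (\<sigma> n) ?k"
            unfolding P_def
            by (rule eventually_less_of_tendsto[OF dl rl]) (use Pi[OF y False, of t] in \<open>simp add: P_def\<close>)
          \<comment> \<open>Off \<open>N\<close> the finitely many earlier candidates fail with
            strict inequality, so they keep failing along the sequence.\<close>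
          moreover have "\<forall>\<^sub>F n in sequentially. \<forall>j\<in>{..<?k}. \<not> P t (\<sigma> n) j"
          proof (rule eventually_ball_finite)
            show "\<forall>j\<in>{..<?k}. \<forall>\<^sub>F n in sequentially. \<not> P t (\<sigma> n) j"
            proof
              fix j assume "j \<in> {..<?k}"
              then have "\<not> P t y j" unfolding i_def using not_less_Least by blast
              moreover have "d y (x j) \<noteq> (2 + \<bar>t\<bar>) * ?\<delta> y" using t by (auto simp: N_def)
              ultimately have "(2 + \<bar>t\<bar>) * ?\<delta> y < d y (x j)" by (simp add: P_def)
              from eventually_less_of_tendsto[OF rl dl this] show "\<forall>\<^sub>F n in sequentially. \<not> P t (\<sigma> n) j"
                by eventually_elim (simp add: P_def)
            qed
          qed simp
          moreover have "\<forall>\<^sub>F n in sequentially. 0 < ?\<delta> (\<sigma> n)"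
            by (rule order_tendstoD(1)[OF \<delta> pos[OF y False]])
          ultimately have "\<forall>\<^sub>F n in sequentially. r t (\<sigma> n) = r t y"
          proof eventually_elim
            case (elim n)
            have "i t (\<sigma> n) = ?k"
              unfolding i_def[of t "\<sigma> n"]
              by (rule Least_equality) (use elim in \<open>auto simp: not_less[symmetric]\<close>)
            moreover have "\<sigma> n \<notin> S" using elim(3) \<sigma>(2) mdist_set_eq_0_iff[OF S(2) clS, of "\<sigma> n"] by auto
            ultimately show ?case using False by (simp add: r_def)
          qed
          moreover have "r t y \<in> M" using xM False by (simp add: r_def)
          ultimately show "limitin mtopology (\<lambda>n. r t (\<sigma> n)) (r t y) sequentially"
            by (intro limitin_eventually) auto
        qed
      qed
    qed
  qed
qed

end

section \<open>Continuity of operators in the compact-open topology\<close>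

text \<open>Finitely many balls of radius \<open>e/4\<close> cover the range of \<open>p\<close>.
  Requiring \<open>q\<close> to map the compact preimage of each closed ball into the ball of radius
  \<open>e/2\<close> keeps \<open>q\<close> within \<open>3e/4\<close> of \<open>p\<close>.\<close>

lemma compact_open_uniform_neighbourhood:
  assumes Z: "compact_space Z" and p: "p \<in> cont_fun Z" and e: "e > 0"
  shows "\<exists>W. openin (compact_open_topology Z) W \<and> p \<in> W \<and>
    (\<forall>q\<in>W. \<forall>z\<in>topspace Z. \<bar>q z - p z\<bar> < e)"
proof -
  have cp: "continuous_map Z euclideanreal p" using p by (simp add: cont_fun_def)
  have "compact (p ` topspace Z)"
    using image_compactin[of Z "topspace Z" euclideanreal p] Z cp by (simp add: compact_space_def)
  then obtain k where k: "finite k" "p ` topspace Z \<subseteq> (\<Union>c\<in>k. ball c (e/4))"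
    using seq_compact_imp_totally_bounded[OF compact_imp_seq_compact, of "p ` topspace Z"] e
    by (meson zero_less_divide_iff zero_less_numeral)
  define K where "K c = {z \<in> topspace Z. p z \<in> cball c (e/4)}" for c
  have K: "compactin Z (K c)" for c
    unfolding K_def using Z cp by (intro closedin_compact_space closedin_continuous_map_preimage) auto
  define V where "V c = {f \<in> cont_fun Z. f ` K c \<subseteq> ball c (e/2)}" for c
  have "openin (compact_open_topology Z) (V c)" for c
    unfolding compact_open_topology_def V_def
    by (rule topology_generated_by_Basis) (use K in auto)
  \<comment> \<open>The factor \<open>cont_fun Z\<close> makes the intersection meaningful also when
    \<open>k\<close> is empty.\<close>
  then have "openin (compact_open_topology Z) ((\<Inter>c\<in>k. V c) \<inter> cont_fun Z)"
    using openin_INT[OF k(1), of "compact_open_topology Z" V] by simp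
  moreover have "p \<in> (\<Inter>c\<in>k. V c) \<inter> cont_fun Z"
    using p e by (auto simp: V_def K_def)
  moreover have "\<bar>q z - p z\<bar> < e" if q: "q \<in> (\<Inter>c\<in>k. V c) \<inter> cont_fun Z" and z: "z \<in> topspace Z" for q z
  proof -
    obtain c where c: "c \<in> k" "p z \<in> ball c (e/4)" using k z by auto
    then have "z \<in> K c" using z by (auto simp: K_def)
    then have "q z \<in> ball c (e/2)" using q c unfolding V_def by blast
    with c have "\<bar>c - p z\<bar> < e/4" "\<bar>c - q z\<bar> < e/2" by (simp_all add: dist_real_def)
    then show ?thesis using e by linarith
  qed
  ultimately show ?thesis by blast
qed

text \<open>A subbasic condition on \<open>T p\<close> tests it on one compact set \<open>K\<close>.
  The compact image of \<open>K\<close> has an \<open>e\<close>-neighbourhood inside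
  \<open>U\<close>, and the Lipschitz bound turns this margin into a uniform neighbourhood of
  \<open>p\<close>.\<close>

lemma continuous_map_compact_open_Lipschitz:
  assumes Z: "compact_space Z" and A: "A \<subseteq> cont_fun Z" and T: "T ` A \<subseteq> A'" and A': "A' \<subseteq> cont_fun Z'"
    and c: "c \<ge> 0"
    and lip: "\<And>p q e w. p \<in> A \<Longrightarrow> q \<in> A \<Longrightarrow> (\<And>z. z \<in> topspace Z \<Longrightarrow> \<bar>q z - p z\<bar> \<le> e) \<Longrightarrow>
      w \<in> topspace Z' \<Longrightarrow> \<bar>T q w - T p w\<bar> \<le> c * e"
  shows "continuous_map (subtopology (compact_open_topology Z) A) (subtopology (compact_open_topology Z') A') T"
proof -
  have "continuous_map (subtopology (compact_open_topology Z) A) (compact_open_topology Z') T"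
    unfolding compact_open_topology_def[of Z']
  proof (rule continuous_on_generated_topo)
    have "cont_fun Z' \<in> {{f \<in> cont_fun Z'. f ` K \<subseteq> U} |K U. compactin Z' K \<and> open U}"
      by (rule CollectI, rule exI[of _ "{}"], rule exI[of _ UNIV]) auto
    moreover have "T ` topspace (subtopology (compact_open_topology Z) A) \<subseteq> cont_fun Z'"
      using T A' by auto
    ultimately show "T ` topspace (subtopology (compact_open_topology Z) A)
        \<subseteq> \<Union>{{f \<in> cont_fun Z'. f ` K \<subseteq> U} |K U. compactin Z' K \<and> open U}" by blast
  next
    fix O' assume "O' \<in> {{f \<in> cont_fun Z'. f ` K \<subseteq> U} |K U. compactin Z' K \<and> open U}"
    then obtain K U where O': "O' = {f \<in> cont_fun Z'. f ` K \<subseteq> U}" and K: "compactin Z' K" and U: "open U" by auto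
    show "openin (subtopology (compact_open_topology Z) A)
        (T -` O' \<inter> topspace (subtopology (compact_open_topology Z) A))"
    proof (subst openin_subopen, intro ballI)
      fix p assume "p \<in> T -` O' \<inter> topspace (subtopology (compact_open_topology Z) A)"
      then have p: "p \<in> A" "T p ` K \<subseteq> U" by (auto simp: O')
      have "T p \<in> cont_fun Z'" using p T A' by auto
      then have "compact (T p ` K)"
        using image_compactin[OF K, of euclideanreal "T p"] by (simp add: cont_fun_def)
      then obtain e where e: "e > 0" "(\<Union>v\<in>T p ` K. ball v e) \<subseteq> U"
        using compact_subset_open_imp_ball_epsilon_subset[OF _ U p(2)] by blast
      have pZ: "p \<in> cont_fun Z" using p A by blast
      \<comment> \<open>Dividing by \<open>c + 1\<close> covers \<open>c = 0\<close> and leaves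
        \<open>c * (e / (c + 1))\<close> strictly below \<open>e\<close>.\<close>
      have "e / (c + 1) > 0" using e c by simp
      from compact_open_uniform_neighbourhood[OF Z pZ this]
      obtain W where W: "openin (compact_open_topology Z) W" "p \<in> W"
        "\<forall>q\<in>W. \<forall>z\<in>topspace Z. \<bar>q z - p z\<bar> < e / (c + 1)" by blast
      have "W \<inter> A \<subseteq> T -` O' \<inter> topspace (subtopology (compact_open_topology Z) A)"
      proof
        fix q assume q: "q \<in> W \<inter> A"
        have "T q w \<in> U" if w: "w \<in> K" for w
        proof -
          have "w \<in> topspace Z'" using w K compactin_subset_topspace by blast
          then have "\<bar>T q w - T p w\<bar> \<le> c * (e / (c + 1))"
            using q p W(3) by (intro lip) (auto intro: less_imp_le)
          also have "\<dots> < e" using e c by (simp add: field_simps)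
          finally have "T q w \<in> ball (T p w) e" by (simp add: dist_real_def abs_minus_commute)
          then show ?thesis using e(2) w by blast
        qed
        moreover have "T q \<in> cont_fun Z'" using q T A' by auto
        ultimately show "q \<in> T -` O' \<inter> topspace (subtopology (compact_open_topology Z) A)"
          using q A by (auto simp: O')
      qed
      moreover have "openin (subtopology (compact_open_topology Z) A) (W \<inter> A)"
        using W(1) by (rule openin_subtopology_Int)
      ultimately show "\<exists>V. openin (subtopology (compact_open_topology Z) A) V \<and> p \<in> V \<and>
          V \<subseteq> T -` O' \<inter> topspace (subtopology (compact_open_topology Z) A)"
        using W(2) p(1) by blast
    qed
  qed
  then show ?thesis using T A by (auto simp: continuous_map_in_subtopology)
qed

section \<open>Invariant metrics\<close>

text \<open>The supremum of a bounded metric over the group is invariant and still bounded by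
  \<open>c\<close>. It only enlarges the metric, so no open set of \<open>Y\<close> is lost; none is
  gained because, by compactness of the group, points near \<open>x\<close> have all their
  translates close to those of \<open>x\<close> at once.\<close>

lemma invariant_metric_exists:
  fixes G :: "('g, 'm) monoid_scheme" (structure)
  assumes G: "compact_topological_group G TG" and Y: "G_space G TG Y \<phi>"
    and metr: "metrizable_space Y" and c: "c > 0"
  shows "\<exists>D. Metric_space (topspace Y) D \<and> Metric_space.mtopology (topspace Y) D = Y \<and>
    (\<forall>y z. D y z \<le> c) \<and>
    (\<forall>g\<in>carrier G. \<forall>y\<in>topspace Y. \<forall>z\<in>topspace Y. D (\<phi> g y) (\<phi> g z) = D y z)"
proof -
  interpret compact_topological_group G TG by fact
  interpret G_space G TG Y \<phi> by fact
  let ?E = "topspace Y"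
  obtain M0 d0 where "Metric_space M0 d0" "Y = Metric_space.mtopology M0 d0"
    using metr unfolding metrizable_space_def by blast
  then have "mtopology_of (metric (M0, d0)) = Y" by (simp add: Metric_space.mtopology_of)
  then obtain m where mt: "mtopology_of m = Y" and lt: "\<And>x y. mdist m x y < c"
    using bounded_equivalent_metric[OF c, of "metric (M0, d0)"] by metis
  have ms: "mspace m = ?E" using mt topspace_mtopology_of by metis
  let ?d = "mdist m"
  define D where "D y z = (SUP g\<in>carrier G. ?d (\<phi> g y) (\<phi> g z))" for y z
  have act: "\<phi> g y \<in> ?E" if "g \<in> carrier G" "y \<in> ?E" for g y
    using element_image that by blast
  have one: "\<phi> \<one> y = y" if "y \<in> ?E" for y using id_eq_one that by (metis restrict_apply')
  have upper: "?d (\<phi> g y) (\<phi> g z) \<le> D y z" if "g \<in> carrier G" for g y z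
    unfolding D_def by (rule cSUP_upper[OF that]) (auto intro!: bdd_aboveI[of _ c] less_imp_le lt)
  have least: "D y z \<le> B" if "\<And>g. g \<in> carrier G \<Longrightarrow> ?d (\<phi> g y) (\<phi> g z) \<le> B" for y z B
    unfolding D_def by (rule cSUP_least) (use that one_closed in auto)
  have ge: "?d y z \<le> D y z" if "y \<in> ?E" "z \<in> ?E" for y z
    using upper[OF one_closed, of y z] one that by simp
  have D: "Metric_space ?E D"
  proof
    show "0 \<le> D y z" for y z using order_trans[OF mdist_nonneg upper[OF one_closed, of y z]] .
    show "D y z = D z y" for y z
      unfolding D_def by (rule SUP_cong[OF refl]) (rule mdist_commute)
    show "D y z = 0 \<longleftrightarrow> y = z" if yz: "y \<in> ?E" "z \<in> ?E" for y z
    proof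
      assume "D y z = 0"
      then have "?d y z = 0" using ge[OF yz] mdist_nonneg[of m y z] by linarith
      then show "y = z" using yz ms by simp
    next
      assume "y = z"
      have "?d w w = 0" if "w \<in> ?E" for w using that ms by simp
      then have "D y z \<le> 0" using yz act \<open>y = z\<close> by (intro least) simp
      then show "D y z = 0" using upper[OF one_closed, of y z] mdist_nonneg[of m "\<phi> \<one> y" "\<phi> \<one> z"] by linarith
    qed
    show "D x z \<le> D x y + D y z" if "x \<in> ?E" "y \<in> ?E" "z \<in> ?E" for x y z
    proof (rule least)
      fix g assume g: "g \<in> carrier G"
      have "?d (\<phi> g x) (\<phi> g z) \<le> ?d (\<phi> g x) (\<phi> g y) + ?d (\<phi> g y) (\<phi> g z)"
        using act g that ms by (intro mdist_triangle) auto
      then show "?d (\<phi> g x) (\<phi> g z) \<le> D x y + D y z" using upper[OF g, of x y] upper[OF g, of y z] by linarith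
    qed
  qed
  interpret D: Metric_space ?E D by fact
  have "openin D.mtopology U \<longleftrightarrow> openin Y U" for U
  proof
    assume U: "openin D.mtopology U"
    show "openin Y U"
    proof (subst openin_subopen, intro ballI)
      fix x assume x: "x \<in> U"
      then obtain s where s: "s > 0" "D.mball x s \<subseteq> U" using U by (auto simp: D.openin_mtopology)
      have xE: "x \<in> ?E" using x U D.openin_mtopology by blast
      have c1: "continuous_map (prod_topology TG Y) (mtopology_of m) (\<lambda>u. \<phi> (fst u) (snd u))"
        using continuous_action by (simp add: mt case_prod_unfold)
      have "continuous_map (prod_topology TG Y) (prod_topology TG Y) (\<lambda>u. (fst u, x))"
        using xE by (simp add: continuous_map_paired continuous_map_fst)
      from continuous_map_compose[OF this c1]
      have c2: "continuous_map (prod_topology TG Y) (mtopology_of m) (\<lambda>u. \<phi> (fst u) x)" by (simp add: o_def)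
      have "continuous_map (prod_topology TG Y) euclideanreal (\<lambda>u. ?d (\<phi> (fst u) x) (\<phi> (fst u) (snd u)))"
        by (intro continuous_map_mdist c1 c2)
      from uniform_tube[OF compact_TG this xE, of "s/2"] s
      obtain V where V: "openin Y V" "x \<in> V"
        "\<And>w g. w \<in> V \<Longrightarrow> g \<in> carrier G \<Longrightarrow> \<bar>?d (\<phi> g x) (\<phi> g w) - ?d (\<phi> g x) (\<phi> g x)\<bar> < s/2"
        by (auto simp: topspace_TG)
      have "V \<subseteq> D.mball x s"
      proof
        fix w assume w: "w \<in> V"
        have "D x w \<le> s/2"
        proof (rule least)
          fix g assume g: "g \<in> carrier G"
          have "?d (\<phi> g x) (\<phi> g x) = 0" using act[OF g xE] ms by simp
          then show "?d (\<phi> g x) (\<phi> g w) \<le> s/2" using V(3)[OF w g] by linarith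
        qed
        moreover have "w \<in> ?E" using w V(1) openin_subset by blast
        ultimately show "w \<in> D.mball x s" using xE s by simp
      qed
      then show "\<exists>V. openin Y V \<and> x \<in> V \<and> V \<subseteq> U" using V s by blast
    qed
  next
    assume U: "openin Y U"
    have "Metric_space.mtopology (mspace m) ?d = Y" using mt by (simp add: mtopology_of_def)
    with U have "openin (Metric_space.mtopology (mspace m) ?d) U" by simp
    then have "\<forall>x\<in>U. \<exists>r>0. Metric_space.mball (mspace m) ?d x r \<subseteq> U"
      by (simp add: Metric_space.openin_mtopology[OF Metric_space_mspace_mdist])
    moreover have "D.mball x r \<subseteq> Metric_space.mball (mspace m) ?d x r" for x r
    proof
      fix w assume w: "w \<in> D.mball x r"
      then show "w \<in> Metric_space.mball (mspace m) ?d x r"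
        using ge[of x w] unfolding Metric_space.in_mball[OF Metric_space_mspace_mdist] by (simp add: ms)
    qed
    moreover have "U \<subseteq> ?E" using U by (rule openin_subset)
    ultimately show "openin D.mtopology U" unfolding D.openin_mtopology by (meson subset_trans)
  qed
  then have "D.mtopology = Y" by (simp add: topology_eq)
  moreover have "D y z \<le> c" for y z using least lt less_imp_le by metis
  moreover have "D (\<phi> k y) (\<phi> k z) = D y z" if k: "k \<in> carrier G" and yz: "y \<in> ?E" "z \<in> ?E" for k y z
  proof (rule antisym)
    show "D (\<phi> k y) (\<phi> k z) \<le> D y z"
    proof (rule least)
      fix g assume "g \<in> carrier G"
      then show "?d (\<phi> g (\<phi> k y)) (\<phi> g (\<phi> k z)) \<le> D y z"
        using upper[of "g \<otimes> k" y z] k yz by (simp add: composition_rule)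
    qed
    show "D y z \<le> D (\<phi> k y) (\<phi> k z)"
    proof (rule least)
      fix g assume g: "g \<in> carrier G"
      have "\<phi> (g \<otimes> inv k) (\<phi> k w) = \<phi> g w" if "w \<in> ?E" for w
        using composition_rule[OF that, of "g \<otimes> inv k" k] g k by (simp add: m_assoc)
      then show "?d (\<phi> g y) (\<phi> g z) \<le> D (\<phi> k y) (\<phi> k z)"
        using upper[of "g \<otimes> inv k" "\<phi> k y" "\<phi> k z"] g k yz by simp
    qed
  qed
  ultimately show ?thesis using D by blast
qed

section \<open>The extension operator\<close>

text \<open>Here \<open>c\<close> bounds the metric and becomes the excess of the norm over 1. The
  assumption \<open>M_finite\<close> serves the pointwise continuity.\<close>

locale equivariant_extension =
  compact_topological_group G TG + G_space G TG Y \<phi> + Y: Metric_space "topspace Y" D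
  for G :: "('g, 'm) monoid_scheme" (structure) and TG and Y :: "'y topology" and \<phi> and D +
  fixes X :: "'y set" and c :: real and M :: "('g \<Rightarrow> real) \<Rightarrow> real"
    and r :: "real \<Rightarrow> 'y \<Rightarrow> 'y" and a b :: 'y
  assumes mtopology_D: "Y.mtopology = Y"
    and D_le: "\<And>y z. D y z \<le> c"
    and D_invariant: "\<And>g y z. g \<in> carrier G \<Longrightarrow> y \<in> topspace Y \<Longrightarrow> z \<in> topspace Y \<Longrightarrow> D (\<phi> g y) (\<phi> g z) = D y z"
    and compact_X: "compactin Y X"
    and X_invariant: "invariant_subset G \<phi> X"
    and a: "a \<in> X" and b: "b \<in> X" and a_neq_b: "a \<noteq> b"
    and M: "invariant_mean M"
    and M_finite: "finite (carrier G) \<Longrightarrow> M = (\<lambda>f. (\<Sum>x\<in>carrier G. f x) / card (carrier G))"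
    and r_in: "\<And>t y. r t y \<in> X"
    and r_X: "\<And>t x. x \<in> X \<Longrightarrow> r t x = x"
    and r_simple: "\<And>y. y \<in> topspace Y \<Longrightarrow> simple_function borel (\<lambda>t. r t y)"
    and r_limit: "\<And>\<sigma> y. limitin Y \<sigma> y sequentially \<Longrightarrow> range \<sigma> \<subseteq> topspace Y \<Longrightarrow>
      AE t in lborel. limitin Y (\<lambda>n. r t (\<sigma> n)) (r t y) sequentially"
begin

abbreviation (input) E where "E \<equiv> topspace Y"
abbreviation (input) TX where "TX \<equiv> subtopology Y X"
abbreviation (input) U :: "real measure" where "U \<equiv> uniform_measure lborel {0..1}"

lemma X_subset: "X \<subseteq> E"
  using compactin_subset_topspace[OF compact_X] .

lemma topspace_Int_X: "E \<inter> X = X"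
  using X_subset by auto

lemma topspace_TX: "topspace TX = X"
  by (simp add: topspace_Int_X)

lemma action_closed: "g \<in> carrier G \<Longrightarrow> y \<in> E \<Longrightarrow> \<phi> g y \<in> E"
  using element_image by blast

lemma action_X: "g \<in> carrier G \<Longrightarrow> x \<in> X \<Longrightarrow> \<phi> g x \<in> X"
  using X_invariant by (auto simp: invariant_subset_def)

lemma prob_U: "prob_space U"
  by (rule prob_space_uniform_measure) auto

sublocale U: prob_space U
  by (rule prob_U)

lemma in_C_inv_TX:
  "p \<in> C_inv G \<phi> TX \<longleftrightarrow> p \<in> extensional (X \<times> X) \<and> continuous_map (prod_topology TX TX) euclideanreal p \<and>
    (\<forall>g\<in>carrier G. \<forall>x\<in>X. \<forall>y\<in>X. p (\<phi> g x, \<phi> g y) = p (x, y))"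
  by (simp add: C_inv_def cont_fun_def topspace_Int_X)

lemma compact_space_TX: "compact_space (prod_topology TX TX)"
  using compact_X by (simp add: compact_space_prod_topology compact_space_subtopology)

lemma C_inv_bounded:
  assumes p: "p \<in> C_inv G \<phi> TX"
  shows "\<exists>B. \<forall>u\<in>X \<times> X. \<bar>p u\<bar> \<le> B"
proof -
  have "compact (p ` (X \<times> X))"
    using image_compactin[of "prod_topology TX TX" "X \<times> X" euclideanreal p] p compact_space_TX
    by (simp add: in_C_inv_TX compact_space_def topspace_Int_X)
  then have "bounded (p ` (X \<times> X))" by (rule compact_imp_bounded)
  then show ?thesis by (auto simp: bounded_iff)
qed

subsection \<open>Averaging over the random retraction\<close>

definition H :: "('y \<times> 'y \<Rightarrow> real) \<Rightarrow> 'y \<Rightarrow> 'y \<Rightarrow> real" where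
  "H p y z = (\<integral>t. p (r t y, r t z) \<partial>U)"

text \<open>Measurability comes from \<open>r\<close> taking finitely many values at each point; it
  therefore holds for arbitrary \<open>p\<close> and without any sigma-algebra on
  \<open>Y\<close>.\<close>

lemma simple_pair:
  fixes p :: "'y \<times> 'y \<Rightarrow> 'b"
  assumes "y \<in> E" "z \<in> E"
  shows "simple_function U (\<lambda>t. p (r t y, r t z))"
proof -
  have "simple_function borel (\<lambda>t. p (r t y, r t z))"
    by (rule simple_function_compose2[OF r_simple[OF assms(1)] r_simple[OF assms(2)]])
  moreover have "simple_function U f \<longleftrightarrow> simple_function borel f" for f :: "real \<Rightarrow> 'b"
    by (rule simple_function_cong_algebra) simp_all
  ultimately show ?thesis by blast
qed

lemma integrable_pair:
  fixes p :: "'y \<times> 'y \<Rightarrow> real"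
  assumes "y \<in> E" "z \<in> E"
  shows "integrable U (\<lambda>t. p (r t y, r t z))"
proof -
  note s = simple_pair[OF assms, of p]
  have "finite ((\<lambda>t. p (r t y, r t z)) ` UNIV)" using s by (simp add: simple_function_def)
  then obtain B where "\<forall>v\<in>range (\<lambda>t. p (r t y, r t z)). norm v \<le> B"
    using finite_imp_bounded bounded_iff by metis
  then show ?thesis
    by (intro U.integrable_const_bound[of _ B] borel_measurable_simple_function s) auto
qed

lemma H_mono:
  assumes "\<And>u. u \<in> X \<times> X \<Longrightarrow> p u \<le> q u" "y \<in> E" "z \<in> E"
  shows "H p y z \<le> H q y z"
  unfolding H_def by (rule integral_mono) (use assms integrable_pair r_in in auto)

lemma H_cong:
  assumes "\<And>u. u \<in> X \<times> X \<Longrightarrow> p u = q u"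
  shows "H p y z = H q y z"
  unfolding H_def using assms r_in by (intro Bochner_Integration.integral_cong) auto

lemma H_linear:
  assumes "y \<in> E" "z \<in> E"
  shows "H (\<lambda>u. s * p u + t * q u) y z = s * H p y z + t * H q y z"
  unfolding H_def using integrable_pair[OF assms] by simp

lemma H_const: "H (\<lambda>_. s) y z = s"
  unfolding H_def by (simp add: U.prob_space[simplified])

lemma H_X: "x \<in> X \<Longrightarrow> y \<in> X \<Longrightarrow> H p x y = p (x, y)"
  unfolding H_def by (simp add: r_X U.prob_space[simplified])

lemma H_diag:
  assumes "\<And>x. x \<in> X \<Longrightarrow> p (x, x) = 0"
  shows "H p y y = 0"
  unfolding H_def using assms r_in by simp

lemma H_triangle:
  assumes p: "\<And>x y z. x \<in> X \<Longrightarrow> y \<in> X \<Longrightarrow> z \<in> X \<Longrightarrow> p (x, z) \<le> p (x, y) + p (y, z)"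
    and E: "x \<in> E" "y \<in> E" "z \<in> E"
  shows "H p x z \<le> H p x y + H p y z"
proof -
  have "H p x z \<le> (\<integral>t. p (r t x, r t y) + p (r t y, r t z) \<partial>U)"
    unfolding H_def using E
    by (intro integral_mono Bochner_Integration.integrable_add integrable_pair) (auto intro: p r_in)
  also have "\<dots> = H p x y + H p y z"
    unfolding H_def using E by (intro Bochner_Integration.integral_add integrable_pair)
  finally show ?thesis .
qed

lemma H_symmetric:
  assumes "\<And>x y. x \<in> X \<Longrightarrow> y \<in> X \<Longrightarrow> p (x, y) = p (y, x)"
  shows "H p y z = H p z y"
  unfolding H_def using assms r_in by (intro Bochner_Integration.integral_cong) auto

text \<open>For almost every \<open>t\<close> both retracted sequences converge inside
  \<open>X\<close>, where \<open>p\<close> is continuous. The bound of \<open>p\<close> on the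
  compact square of \<open>X\<close> dominates.\<close>

lemma H_continuous:
  assumes p: "p \<in> C_inv G \<phi> TX"
  shows "continuous_map (prod_topology Y Y) euclideanreal (\<lambda>u. H p (fst u) (snd u))"
proof (rule continuous_map_real_sequentially)
  show "metrizable_space (prod_topology Y Y)"
    using Y.metrizable_space_mtopology by (simp add: mtopology_D metrizable_space_prod_topology)
  fix \<sigma> :: "nat \<Rightarrow> 'y \<times> 'y" and l
  assume lim: "limitin (prod_topology Y Y) \<sigma> l sequentially" and rng: "range \<sigma> \<subseteq> topspace (prod_topology Y Y)"
  have \<sigma>E: "fst (\<sigma> n) \<in> E" "snd (\<sigma> n) \<in> E" for n using rng by (auto simp: mem_Times_iff image_subset_iff)
  have lim1: "limitin Y (\<lambda>n. fst (\<sigma> n)) (fst l) sequentially" and lim2: "limitin Y (\<lambda>n. snd (\<sigma> n)) (snd l) sequentially"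
    using lim by (auto simp: limitin_pairwise o_def)
  have lE: "fst l \<in> E" "snd l \<in> E" using lim1 lim2 by (auto simp: limitin_def)
  obtain B where B: "\<And>u. u \<in> X \<times> X \<Longrightarrow> \<bar>p u\<bar> \<le> B" using C_inv_bounded[OF p] by blast
  have pc: "continuous_map (prod_topology TX TX) euclideanreal p" using p by (simp add: in_C_inv_TX)
  have "AE t in lborel. limitin Y (\<lambda>n. r t (fst (\<sigma> n))) (r t (fst l)) sequentially"
    by (rule r_limit[OF lim1]) (use \<sigma>E in auto)
  moreover have "AE t in lborel. limitin Y (\<lambda>n. r t (snd (\<sigma> n))) (r t (snd l)) sequentially"
    by (rule r_limit[OF lim2]) (use \<sigma>E in auto)
  ultimately have "AE t in lborel. (\<lambda>n. p (r t (fst (\<sigma> n)), r t (snd (\<sigma> n)))) \<longlonglongrightarrow> p (r t (fst l), r t (snd l))"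
  proof eventually_elim
    case (elim t)
    then have "limitin (prod_topology TX TX) (\<lambda>n. (r t (fst (\<sigma> n)), r t (snd (\<sigma> n)))) (r t (fst l), r t (snd l)) sequentially"
      by (simp add: limitin_pairwise o_def limitin_subtopology r_in)
    from continuous_map_limit[OF pc this] show ?case by (simp add: o_def)
  qed
  then have ae: "AE t in U. (\<lambda>n. p (r t (fst (\<sigma> n)), r t (snd (\<sigma> n)))) \<longlonglongrightarrow> p (r t (fst l), r t (snd l))"
    by (intro AE_uniform_measureI) auto
  show "(\<lambda>n. H p (fst (\<sigma> n)) (snd (\<sigma> n))) \<longlonglongrightarrow> H p (fst l) (snd l)"
    unfolding H_def
    by (rule integral_dominated_convergence[OF _ _ _ ae, of "\<lambda>_. B"])
      (use lE \<sigma>E B r_in in \<open>auto intro!: borel_measurable_simple_function simple_pair\<close>)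
qed

text \<open>The points and weights are chosen before \<open>p\<close>: the weights are the
  probabilities of the finitely many values of the random pair.\<close>

lemma H_finite_combination:
  assumes "y \<in> E" "z \<in> E"
  shows "\<exists>F w. finite F \<and> F \<subseteq> X \<times> X \<and> (\<forall>p. H p y z = (\<Sum>u\<in>F. w u * p u))"
proof -
  define f where "f t = (r t y, r t z)" for t
  have s: "simple_function U f" unfolding f_def using simple_pair[OF assms, of "\<lambda>u. u"] by simp
  define F where "F = range f"
  have F: "finite F" using s by (simp add: F_def simple_function_def)
  define A where "A u = f -` {u}" for u
  have A: "A u \<in> sets U" for u
    using simple_functionD(2)[OF s, of "{u}"] by (simp add: A_def)
  have "H p y z = (\<Sum>u\<in>F. measure U (A u) * p u)" for p
  proof -
    have "H p y z = (\<integral>t. (\<Sum>u\<in>F. indicator (A u) t * p u) \<partial>U)"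
      unfolding H_def
    proof (rule Bochner_Integration.integral_cong[OF refl])
      fix t
      have "(\<Sum>u\<in>F. indicator (A u) t * p u) = (\<Sum>u\<in>F. if u = f t then p u else 0)"
        by (rule sum.cong) (auto simp: A_def indicator_def)
      also have "\<dots> = p (f t)" using F by (simp add: F_def)
      finally show "p (r t y, r t z) = (\<Sum>u\<in>F. indicator (A u) t * p u)" by (simp add: f_def)
    qed
    also have "\<dots> = (\<Sum>u\<in>F. \<integral>t. indicator (A u) t * p u \<partial>U)"
    proof (intro Bochner_Integration.integral_sum integrable_mult_left)
      show "integrable U (indicator (A u) :: real \<Rightarrow> real)" for u
        using A by (intro U.integrable_const_bound[of _ 1] borel_measurable_indicator) auto
    qed
    also have "\<dots> = (\<Sum>u\<in>F. measure U (A u) * p u)" using A by (intro sum.cong) auto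
    finally show ?thesis .
  qed
  then show ?thesis using F r_in by (intro exI[of _ F] exI[of _ "\<lambda>u. measure U (A u)"]) (auto simp: F_def f_def)
qed

subsection \<open>Averaging over the group\<close>

lemma M_linear: "f \<in> CG \<Longrightarrow> g \<in> CG \<Longrightarrow> M (\<lambda>x. s * f x + t * g x) = s * M f + t * M g"
  by (rule conjunct1[OF M[unfolded invariant_mean_def], rule_format])

lemma M_one: "M (\<lambda>_. 1) = 1"
  using M unfolding invariant_mean_def by blast

lemma M_const: "M (\<lambda>_. s) = s"
  using M_linear[of "\<lambda>_. 1" "\<lambda>_. 1" s 0] M_one by simp

lemma M_mono:
  assumes f: "f \<in> CG" and g: "g \<in> CG" and le: "\<And>x. x \<in> carrier G \<Longrightarrow> f x \<le> g x"
  shows "M f \<le> M g"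
proof -
  have d: "(\<lambda>x. 1 * g x + (- 1) * f x) \<in> CG" using f g by (auto intro!: continuous_intros)
  have nn: "\<forall>x\<in>carrier G. 0 \<le> 1 * g x + (- 1) * f x" using le by auto
  have "0 \<le> M (\<lambda>x. 1 * g x + (- 1) * f x)"
    using bspec[OF conjunct1[OF conjunct2[OF M[unfolded invariant_mean_def]]] d] nn by (rule mp)
  also have "\<dots> = 1 * M g + (- 1) * M f" by (rule M_linear[OF g f])
  finally show ?thesis by simp
qed

lemma M_cong:
  assumes "f \<in> CG" "g \<in> CG" "\<And>x. x \<in> carrier G \<Longrightarrow> f x = g x"
  shows "M f = M g"
  using assms by (intro antisym M_mono) auto

lemma M_translate: "f \<in> CG \<Longrightarrow> k \<in> carrier G \<Longrightarrow> M (\<lambda>x. f (x \<otimes> k)) = M f"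
  by (rule conjunct2[OF conjunct2[OF conjunct2[OF M[unfolded invariant_mean_def]]], rule_format])

definition S :: "('y \<times> 'y \<Rightarrow> real) \<Rightarrow> 'y \<Rightarrow> 'y \<Rightarrow> real" where
  "S p y z = M (\<lambda>g. H p (\<phi> g y) (\<phi> g z))"

lemma H_action_continuous:
  assumes p: "p \<in> C_inv G \<phi> TX"
  shows "continuous_map (prod_topology TG (prod_topology Y Y)) euclideanreal
    (\<lambda>u. H p (\<phi> (fst u) (fst (snd u))) (\<phi> (fst u) (snd (snd u))))"
proof -
  let ?P = "prod_topology TG (prod_topology Y Y)"
  have snd: "continuous_map ?P (prod_topology Y Y) snd" by (rule continuous_map_snd)
  have c: "continuous_map ?P Y (\<lambda>u. \<phi> (fst u) (h u))" if "continuous_map ?P Y h" for h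
  proof -
    have "continuous_map ?P (prod_topology TG Y) (\<lambda>u. (fst u, h u))"
      using that by (simp add: continuous_map_paired continuous_map_fst)
    from continuous_map_compose[OF this continuous_action] show ?thesis by (simp add: o_def)
  qed
  have "continuous_map ?P Y (\<lambda>u. fst (snd u))" "continuous_map ?P Y (\<lambda>u. snd (snd u))"
    using continuous_map_compose[OF snd continuous_map_fst] continuous_map_compose[OF snd continuous_map_snd]
    by (simp_all add: o_def)
  then have "continuous_map ?P (prod_topology Y Y) (\<lambda>u. (\<phi> (fst u) (fst (snd u)), \<phi> (fst u) (snd (snd u))))"
    by (simp add: continuous_map_paired c)
  from continuous_map_compose[OF this H_continuous[OF p]] show ?thesis by (simp add: o_def)
qed

lemma H_orbit_CG:
  assumes p: "p \<in> C_inv G \<phi> TX" and "y \<in> E" "z \<in> E"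
  shows "(\<lambda>g. H p (\<phi> g y) (\<phi> g z)) \<in> CG"
proof -
  have "continuous_map TG (prod_topology TG (prod_topology Y Y)) (\<lambda>g. (g, (y, z)))"
    using assms by (simp add: continuous_map_paired)
  from continuous_map_compose[OF this H_action_continuous[OF p]] show ?thesis by (simp add: o_def)
qed

lemma const_CG: "(\<lambda>_. s) \<in> CG"
  by simp

lemma S_mono:
  assumes "p \<in> C_inv G \<phi> TX" "q \<in> C_inv G \<phi> TX" "\<And>u. u \<in> X \<times> X \<Longrightarrow> p u \<le> q u" "y \<in> E" "z \<in> E"
  shows "S p y z \<le> S q y z"
  unfolding S_def using assms
  by (intro M_mono H_orbit_CG H_mono) (auto simp: action_closed)

lemma S_abs_le:
  assumes "p \<in> C_inv G \<phi> TX" "\<And>u. u \<in> X \<times> X \<Longrightarrow> \<bar>p u\<bar> \<le> B" "y \<in> E" "z \<in> E"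
  shows "\<bar>S p y z\<bar> \<le> B"
proof -
  have le: "H p y z \<le> B" "- B \<le> H p y z" if "y \<in> E" "z \<in> E" for y z
  proof -
    have 1: "p u \<le> B" "- B \<le> p u" if "u \<in> X \<times> X" for u using assms(2)[OF that] by auto
    show "H p y z \<le> B" "- B \<le> H p y z"
      using H_mono[of p "\<lambda>_. B", OF _ that] H_mono[of "\<lambda>_. - B" p, OF _ that] 1 by (auto simp: H_const)
  qed
  have "S p y z \<le> M (\<lambda>_. B)"
    unfolding S_def using assms by (intro M_mono H_orbit_CG const_CG le) (auto simp: action_closed)
  moreover have "M (\<lambda>_. - B) \<le> S p y z"
    unfolding S_def using assms by (intro M_mono H_orbit_CG const_CG le) (auto simp: action_closed)
  ultimately show ?thesis by (simp add: M_const abs_le_iff)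
qed

lemma C_inv_combination:
  assumes p: "p \<in> C_inv G \<phi> TX" and q: "q \<in> C_inv G \<phi> TX"
  shows "(\<lambda>u\<in>X \<times> X. s * p u + t * q u) \<in> C_inv G \<phi> TX"
proof -
  have "continuous_map (prod_topology TX TX) euclideanreal (\<lambda>u. s * p u + t * q u)"
    using p q by (auto simp: in_C_inv_TX intro!: continuous_intros)
  then have "continuous_map (prod_topology TX TX) euclideanreal (\<lambda>u\<in>X \<times> X. s * p u + t * q u)"
    by (rule continuous_map_eq) (auto simp: topspace_TX)
  then show ?thesis using p q action_X by (auto simp: in_C_inv_TX)
qed

lemma S_linear:
  assumes p: "p \<in> C_inv G \<phi> TX" and q: "q \<in> C_inv G \<phi> TX" and yz: "y \<in> E" "z \<in> E"
  shows "S (\<lambda>u\<in>X \<times> X. s * p u + t * q u) y z = s * S p y z + t * S q y z"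
proof -
  let ?q = "\<lambda>u\<in>X \<times> X. s * p u + t * q u"
  have "S ?q y z = M (\<lambda>g. s * H p (\<phi> g y) (\<phi> g z) + t * H q (\<phi> g y) (\<phi> g z))"
    unfolding S_def
  proof (rule M_cong)
    show "(\<lambda>g. H ?q (\<phi> g y) (\<phi> g z)) \<in> CG" by (rule H_orbit_CG[OF C_inv_combination[OF p q] yz])
    show "(\<lambda>g. s * H p (\<phi> g y) (\<phi> g z) + t * H q (\<phi> g y) (\<phi> g z)) \<in> CG"
      using H_orbit_CG[OF p yz] H_orbit_CG[OF q yz] by (auto intro!: continuous_intros)
    fix g assume g: "g \<in> carrier G"
    have "H ?q (\<phi> g y) (\<phi> g z) = H (\<lambda>u. s * p u + t * q u) (\<phi> g y) (\<phi> g z)"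
      by (rule H_cong) simp
    then show "H ?q (\<phi> g y) (\<phi> g z) = s * H p (\<phi> g y) (\<phi> g z) + t * H q (\<phi> g y) (\<phi> g z)"
      using H_linear[of "\<phi> g y" "\<phi> g z"] g yz by (simp add: action_closed)
  qed
  also have "\<dots> = s * S p y z + t * S q y z"
    unfolding S_def by (rule M_linear[OF H_orbit_CG[OF p yz] H_orbit_CG[OF q yz]])
  finally show ?thesis .
qed

text \<open>Replacing \<open>y\<close> and \<open>z\<close> by their images under \<open>k\<close>
  right-translates the function of \<open>g\<close> being averaged.\<close>

lemma S_invariant:
  assumes p: "p \<in> C_inv G \<phi> TX" and k: "k \<in> carrier G" and yz: "y \<in> E" "z \<in> E"
  shows "S p (\<phi> k y) (\<phi> k z) = S p y z"
proof -
  have k': "\<phi> k y \<in> E" "\<phi> k z \<in> E" using k yz by (auto simp: action_closed)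
  have "S p (\<phi> k y) (\<phi> k z) = M (\<lambda>g. H p (\<phi> (g \<otimes> k) y) (\<phi> (g \<otimes> k) z))"
    unfolding S_def
  proof (rule M_cong)
    show "(\<lambda>g. H p (\<phi> g (\<phi> k y)) (\<phi> g (\<phi> k z))) \<in> CG" by (rule H_orbit_CG[OF p k'])
    show "(\<lambda>g. H p (\<phi> (g \<otimes> k) y) (\<phi> (g \<otimes> k) z)) \<in> CG"
      using continuous_right_translation[of euclideanreal "\<lambda>g. H p (\<phi> g y) (\<phi> g z)" k] H_orbit_CG[OF p yz] k by simp
  qed (use k yz in \<open>simp add: composition_rule\<close>)
  also have "\<dots> = S p y z" unfolding S_def by (rule M_translate[OF H_orbit_CG[OF p yz] k])
  finally show ?thesis .
qed

lemma S_X: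
  assumes p: "p \<in> C_inv G \<phi> TX" and xy: "x \<in> X" "y \<in> X"
  shows "S p x y = p (x, y)"
proof -
  have "S p x y = M (\<lambda>_. p (x, y))"
    unfolding S_def
  proof (rule M_cong[OF H_orbit_CG[OF p]])
    fix g assume g: "g \<in> carrier G"
    then show "H p (\<phi> g x) (\<phi> g y) = p (x, y)"
      using p xy by (simp add: H_X action_X in_C_inv_TX)
  qed (use xy X_subset in auto)
  then show ?thesis by (simp add: M_const)
qed

text \<open>\<open>M\<close> is only known to be linear, positive and normalised, so no limit
  theorem is invoked: an estimate uniform in \<open>g\<close> passes through \<open>M\<close> by
  monotonicity.\<close>

lemma S_continuous:
  assumes p: "p \<in> C_inv G \<phi> TX"
  shows "continuous_map (prod_topology Y Y) euclideanreal (\<lambda>u. S p (fst u) (snd u))"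
  unfolding continuous_map_real_iff
proof (intro ballI allI impI)
  fix v e assume v: "v \<in> topspace (prod_topology Y Y)" and e: "(e::real) > 0"
  then have e2: "e/2 > 0" by simp
  from uniform_tube[OF compact_TG H_action_continuous[OF p] v e2]
  obtain W where W: "openin (prod_topology Y Y) W" "v \<in> W"
    "\<And>w g. w \<in> W \<Longrightarrow> g \<in> carrier G \<Longrightarrow>
      \<bar>H p (\<phi> g (fst w)) (\<phi> g (snd w)) - H p (\<phi> g (fst v)) (\<phi> g (snd v))\<bar> < e/2"
    by (auto simp: topspace_TG)
  have "\<bar>S p (fst w) (snd w) - S p (fst v) (snd v)\<bar> < e" if w: "w \<in> W" for w
  proof -
    have wE: "fst w \<in> E" "snd w \<in> E" using openin_subset[OF W(1)] w by auto
    have vE: "fst v \<in> E" "snd v \<in> E" using v by auto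
    note cw = H_orbit_CG[OF p wE] and cv = H_orbit_CG[OF p vE]
    \<comment> \<open>Written in the shape of \<open>M_linear\<close>, so that adding a constant
      commutes with \<open>M\<close>.\<close>
    have shift: "M (\<lambda>g. 1 * f g + (e/2) * 1) = M f + e/2" "(\<lambda>g. 1 * f g + (e/2) * 1) \<in> CG" if "f \<in> CG" for f
      using M_linear[OF that const_CG[of 1], of 1 "e/2"] that by (auto simp: M_one intro!: continuous_intros)
    have "S p (fst w) (snd w) \<le> S p (fst v) (snd v) + e/2"
      unfolding S_def shift(1)[OF cv, symmetric]
    proof (rule M_mono[OF cw shift(2)[OF cv]])
      fix g assume "g \<in> carrier G"
      from W(3)[OF w this] show "H p (\<phi> g (fst w)) (\<phi> g (snd w)) \<le> 1 * H p (\<phi> g (fst v)) (\<phi> g (snd v)) + e/2 * 1"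
        by linarith
    qed
    moreover have "S p (fst v) (snd v) \<le> S p (fst w) (snd w) + e/2"
      unfolding S_def shift(1)[OF cw, symmetric]
    proof (rule M_mono[OF cv shift(2)[OF cw]])
      fix g assume "g \<in> carrier G"
      from W(3)[OF w this] show "H p (\<phi> g (fst v)) (\<phi> g (snd v)) \<le> 1 * H p (\<phi> g (fst w)) (\<phi> g (snd w)) + e/2 * 1"
        by linarith
    qed
    ultimately show ?thesis using e by linarith
  qed
  with W show "\<exists>W. openin (prod_topology Y Y) W \<and> v \<in> W \<and>
      (\<forall>w\<in>W. \<bar>S p (fst w) (snd w) - S p (fst v) (snd v)\<bar> < e)" by blast
qed

lemma S_pseudometric:
  assumes p: "p \<in> C_inv G \<phi> TX" and pm: "pseudometric_on X p"
  shows "pseudometric_on E (\<lambda>u. S p (fst u) (snd u))"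
proof -
  note C = H_orbit_CG[OF p]
  have "0 \<le> S p x y" if "x \<in> E" "y \<in> E" for x y
  proof -
    have "M (\<lambda>_. 0) \<le> S p x y"
      unfolding S_def
    proof (rule M_mono[OF const_CG C[OF that]])
      fix g assume "g \<in> carrier G"
      then have "H (\<lambda>_. 0) (\<phi> g x) (\<phi> g y) \<le> H p (\<phi> g x) (\<phi> g y)"
        using pm that by (intro H_mono) (auto simp: pseudometric_on_def action_closed)
      then show "0 \<le> H p (\<phi> g x) (\<phi> g y)" by (simp add: H_const)
    qed
    then show ?thesis by (simp add: M_const)
  qed
  moreover have "S p x x = 0" for x
    unfolding S_def using pm by (simp add: H_diag pseudometric_on_def M_const)
  moreover have "S p x y = S p y x" for x y
  proof -
    have "H p (\<phi> g x) (\<phi> g y) = H p (\<phi> g y) (\<phi> g x)" for g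
      using pm by (intro H_symmetric) (auto simp: pseudometric_on_def)
    then show ?thesis unfolding S_def by simp
  qed
  moreover have "S p x z \<le> S p x y + S p y z" if "x \<in> E" "y \<in> E" "z \<in> E" for x y z
  proof -
    have "S p x z \<le> M (\<lambda>g. 1 * H p (\<phi> g x) (\<phi> g y) + 1 * H p (\<phi> g y) (\<phi> g z))"
      unfolding S_def
    proof (rule M_mono)
      show "(\<lambda>g. H p (\<phi> g x) (\<phi> g z)) \<in> CG" using C that by simp
      show "(\<lambda>g. 1 * H p (\<phi> g x) (\<phi> g y) + 1 * H p (\<phi> g y) (\<phi> g z)) \<in> CG"
        using C[of x y] C[of y z] that by (auto intro!: continuous_intros)
      fix g assume "g \<in> carrier G"
      then show "H p (\<phi> g x) (\<phi> g z) \<le> 1 * H p (\<phi> g x) (\<phi> g y) + 1 * H p (\<phi> g y) (\<phi> g z)"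
        using H_triangle[of p "\<phi> g x" "\<phi> g y" "\<phi> g z"] pm that by (simp add: pseudometric_on_def action_closed)
    qed
    also have "\<dots> = S p x y + S p y z"
      unfolding S_def using M_linear[OF C C, of x y y z 1 1] that by simp
    finally show ?thesis .
  qed
  ultimately show ?thesis unfolding pseudometric_on_def by simp
qed

subsection \<open>The metric with the compact subspace collapsed\<close>

abbreviation (input) \<delta> where "\<delta> \<equiv> Y.mdist_set X"

text \<open>The quotient pseudometric: one goes from \<open>y\<close> to \<open>z\<close> directly,
  or to \<open>X\<close> and from \<open>X\<close> to \<open>z\<close>, moving inside
  \<open>X\<close> for free.\<close>

definition \<rho> :: "'y \<Rightarrow> 'y \<Rightarrow> real" where
  "\<rho> y z = min (D y z) (\<delta> y + \<delta> z)"

lemma X_nonempty: "X \<noteq> {}"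
  using a by blast

lemma closedin_X: "closedin Y.mtopology X"
  using compactin_imp_closedin[OF Y.Hausdorff_space_mtopology] compact_X by (simp add: mtopology_D)

lemma \<delta>_nonneg: "0 \<le> \<delta> y"
  by (rule Y.mdist_set_nonneg[OF X_nonempty])

lemma \<delta>_eq_0_iff: "y \<in> E \<Longrightarrow> \<delta> y = 0 \<longleftrightarrow> y \<in> X"
  by (rule Y.mdist_set_eq_0_iff[OF X_nonempty closedin_X])

lemma \<delta>_triangle: "y \<in> E \<Longrightarrow> z \<in> E \<Longrightarrow> \<delta> y \<le> D y z + \<delta> z"
  by (rule Y.mdist_set_triangle[OF X_nonempty X_subset])

text \<open>Moving points of \<open>X\<close> back by \<open>inv k\<close> gives one inequality; it
  is applied to \<open>g\<close> and to \<open>inv g\<close>.\<close>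

lemma \<delta>_invariant:
  assumes g: "g \<in> carrier G" and y: "y \<in> E"
  shows "\<delta> (\<phi> g y) = \<delta> y"
proof -
  have le: "\<delta> y \<le> \<delta> (\<phi> k y)" if k: "k \<in> carrier G" and y: "y \<in> E" for k y
    unfolding Y.mdist_set_def[of X "\<phi> k y"]
  proof (rule cINF_greatest[OF X_nonempty])
    fix x assume x: "x \<in> X"
    have "\<phi> k (\<phi> (inv k) x) = \<phi> (k \<otimes> inv k) x" using k x X_subset by (subst composition_rule) auto
    also have "\<dots> = x" using k x X_subset id_eq_one by (metis r_inv restrict_apply' subsetD)
    finally have "D (\<phi> k y) x = D y (\<phi> (inv k) x)"
      using D_invariant[OF k y, of "\<phi> (inv k) x"] action_closed[of "inv k" x] k x X_subset by auto
    then show "\<delta> y \<le> D (\<phi> k y) x"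
      using Y.mdist_set_le[of "\<phi> (inv k) x" X y] action_X[of "inv k" x] k x by simp
  qed
  have "\<phi> (inv g) (\<phi> g y) = \<phi> (inv g \<otimes> g) y" using g y by (subst composition_rule) auto
  also have "\<dots> = y" using g y id_eq_one by (metis l_inv restrict_apply')
  finally have "\<delta> (\<phi> g y) \<le> \<delta> y" using le[of "inv g" "\<phi> g y"] g y by (simp add: action_closed)
  with le[OF g y] show ?thesis by simp
qed

lemma \<rho>_nonneg: "0 \<le> \<rho> y z"
  unfolding \<rho>_def using \<delta>_nonneg[of y] \<delta>_nonneg[of z] by simp

lemma \<rho>_le: "\<rho> y z \<le> c"
  unfolding \<rho>_def using D_le[of y z] by simp

lemma \<rho>_X: "y \<in> X \<Longrightarrow> z \<in> X \<Longrightarrow> \<rho> y z = 0"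
proof -
  assume yz: "y \<in> X" "z \<in> X"
  then have "y \<in> E" "z \<in> E" using X_subset by auto
  then have "\<delta> y = 0" "\<delta> z = 0" using \<delta>_eq_0_iff yz by simp_all
  then show ?thesis by (simp add: \<rho>_def)
qed

lemma \<rho>_eq_0:
  assumes "y \<in> E" "z \<in> E" "\<rho> y z = 0"
  shows "y = z \<or> y \<in> X \<and> z \<in> X"
proof (cases "D y z = 0")
  case True then show ?thesis using assms by simp
next
  case False
  then have "\<delta> y + \<delta> z = 0" using assms(3) by (auto simp: \<rho>_def min_def split: if_splits)
  then have "\<delta> y = 0" "\<delta> z = 0" using \<delta>_nonneg[of y] \<delta>_nonneg[of z] by linarith+
  then show ?thesis using \<delta>_eq_0_iff assms by blast
qed

lemma \<rho>_pseudometric: "pseudometric_on E (\<lambda>u. \<rho> (fst u) (snd u))"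
proof -
  \<comment> \<open>Two direct moves use the triangle inequality for \<open>D\<close>, two detours
    use \<delta> being nonnegative at \<open>y\<close>, and the mixed cases use that \<delta> is
    1-Lipschitz.\<close>
  have "\<rho> x z \<le> \<rho> x y + \<rho> y z" if "x \<in> E" "y \<in> E" "z \<in> E" for x y z
    using Y.triangle[OF that] \<delta>_triangle[of x y] \<delta>_triangle[of z y] \<delta>_nonneg[of y] that
    by (simp add: \<rho>_def min_def Y.commute)
  moreover have "\<rho> x x = 0" if "x \<in> E" for x using that \<delta>_nonneg[of x] by (simp add: \<rho>_def)
  ultimately show ?thesis
    unfolding pseudometric_on_def by (auto simp: \<rho>_nonneg) (auto simp: \<rho>_def Y.commute add.commute)
qed

lemma \<delta>_continuous: "continuous_map Y euclideanreal \<delta>"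
  using Y.mdist_set_tendsto[OF X_nonempty X_subset] Y.metrizable_space_mtopology
  by (intro continuous_map_real_sequentially) (auto simp: mtopology_D)

lemma \<rho>_continuous: "continuous_map (prod_topology Y Y) euclideanreal (\<lambda>u. \<rho> (fst u) (snd u))"
proof -
  have mt: "mtopology_of (metric (E, D)) = Y" by (simp add: Y.mtopology_of mtopology_D)
  have "continuous_map (prod_topology Y Y) euclideanreal (\<lambda>u. mdist (metric (E, D)) (fst u) (snd u))"
    by (rule continuous_map_mdist) (simp_all add: mtopology_D continuous_map_fst continuous_map_snd)
  moreover have "continuous_map (prod_topology Y Y) euclideanreal (\<lambda>u. \<delta> (fst u))"
    "continuous_map (prod_topology Y Y) euclideanreal (\<lambda>u. \<delta> (snd u))"
    using continuous_map_compose[OF continuous_map_fst \<delta>_continuous] continuous_map_compose[OF continuous_map_snd \<delta>_continuous]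
    by (simp_all add: o_def)
  ultimately show ?thesis unfolding \<rho>_def by (intro continuous_intros) simp_all
qed

subsection \<open>The operator\<close>

definition T :: "('y \<times> 'y \<Rightarrow> real) \<Rightarrow> 'y \<times> 'y \<Rightarrow> real" where
  "T p = (\<lambda>u\<in>E \<times> E. S p (fst u) (snd u) + p (a, b) * \<rho> (fst u) (snd u))"

lemma T_apply: "y \<in> E \<Longrightarrow> z \<in> E \<Longrightarrow> T p (y, z) = S p y z + p (a, b) * \<rho> y z"
  by (simp add: T_def)

lemma \<rho>_invariant: "g \<in> carrier G \<Longrightarrow> y \<in> E \<Longrightarrow> z \<in> E \<Longrightarrow> \<rho> (\<phi> g y) (\<phi> g z) = \<rho> y z"
  by (simp add: \<rho>_def D_invariant \<delta>_invariant)

lemma T_in_C_inv: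
  assumes p: "p \<in> C_inv G \<phi> TX"
  shows "T p \<in> C_inv G \<phi> Y"
proof -
  have "continuous_map (prod_topology Y Y) euclideanreal (\<lambda>u. S p (fst u) (snd u) + p (a, b) * \<rho> (fst u) (snd u))"
    by (intro continuous_intros S_continuous[OF p] \<rho>_continuous)
  then have "continuous_map (prod_topology Y Y) euclideanreal (T p)"
    by (rule continuous_map_eq) (simp add: T_def)
  then show ?thesis
    by (auto simp: C_inv_def cont_fun_def T_apply action_closed S_invariant[OF p] \<rho>_invariant) (simp add: T_def)
qed

lemma T_X: "p \<in> C_inv G \<phi> TX \<Longrightarrow> x \<in> X \<Longrightarrow> y \<in> X \<Longrightarrow> T p (x, y) = p (x, y)"
  using X_subset by (simp add: T_apply subset_iff S_X \<rho>_X)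

lemma T_extension: "extension_operator G \<phi> TX Y T"
  unfolding extension_operator_def topspace_TX
proof (intro ballI conjI T_in_C_inv ext)
  fix p u assume p: "p \<in> C_inv G \<phi> TX"
  then show "restrict (T p) (X \<times> X) u = p u"
    by (cases u) (auto simp: T_X in_C_inv_TX extensional_def restrict_def)
qed

lemma T_combination:
  assumes p: "p \<in> C_inv G \<phi> TX" and q: "q \<in> C_inv G \<phi> TX" and yz: "y \<in> E" "z \<in> E"
  shows "T (\<lambda>u\<in>X \<times> X. s * p u + t * q u) (y, z) = s * T p (y, z) + t * T q (y, z)"
  using a b by (simp add: T_apply yz S_linear[OF p q yz] algebra_simps)

lemma T_linear: "linear_operator G \<phi> TX Y T"
  unfolding linear_operator_def topspace_TX
proof (intro ballI allI ext)
  fix p q s t u assume p: "p \<in> C_inv G \<phi> TX" and q: "q \<in> C_inv G \<phi> TX"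
  show "T (\<lambda>u\<in>X \<times> X. s * p u + t * q u) u = (\<lambda>u\<in>E \<times> E. s * T p u + t * T q u) u"
  proof (cases "u \<in> E \<times> E")
    case True
    then obtain y z where yz: "u = (y, z)" "y \<in> E" "z \<in> E" by auto
    show ?thesis using T_combination[OF p q yz(2,3)] True unfolding yz(1) by simp
  next
    case False
    then show ?thesis by (simp add: T_def)
  qed
qed

lemma T_abs_le:
  assumes p: "p \<in> C_inv G \<phi> TX" and B: "\<And>u. u \<in> X \<times> X \<Longrightarrow> \<bar>p u\<bar> \<le> B" and yz: "y \<in> E" "z \<in> E"
  shows "\<bar>T p (y, z)\<bar> \<le> (1 + c) * B"
proof -
  have "\<bar>p (a, b)\<bar> * \<bar>\<rho> y z\<bar> \<le> B * c"
    using B[of "(a, b)"] a b \<rho>_nonneg[of y z] \<rho>_le[of y z] by (intro mult_mono) auto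
  then show ?thesis
    using S_abs_le[OF p B yz] by (simp add: T_apply yz algebra_simps abs_mult[symmetric])
qed

lemma zero_in_C_inv: "(\<lambda>u\<in>X \<times> X. 0) \<in> C_inv G \<phi> TX"
proof -
  have "continuous_map (prod_topology TX TX) euclideanreal (\<lambda>u\<in>X \<times> X. 0)"
    by (rule continuous_map_eq[of _ _ "\<lambda>_. 0"]) (auto simp: topspace_Int_X)
  then show ?thesis using action_X by (simp add: in_C_inv_TX)
qed

lemma T_positive: "positive_operator G \<phi> TX Y T"
  unfolding positive_operator_def topspace_TX
proof (intro ballI allI impI)
  fix p u assume p: "p \<in> C_inv G \<phi> TX" and nn: "\<forall>u\<in>X \<times> X. 0 \<le> p u" and u: "u \<in> E \<times> E"
  obtain y z where yz: "u = (y, z)" "y \<in> E" "z \<in> E" using u by auto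
  have "S (\<lambda>u\<in>X \<times> X. 0) y z \<le> S p y z"
    by (rule S_mono[OF zero_in_C_inv p]) (use nn yz in auto)
  moreover have "\<bar>S (\<lambda>u\<in>X \<times> X. 0) y z\<bar> \<le> 0"
    by (rule S_abs_le[OF zero_in_C_inv]) (use yz in auto)
  moreover have "0 \<le> p (a, b) * \<rho> y z" using nn a b \<rho>_nonneg by simp
  ultimately show "0 \<le> T p u" using yz by (simp add: T_apply)
qed

lemma c_nonneg: "0 \<le> c"
  using D_le[of a b] Y.nonneg[of a b] by linarith

lemma T_continuous: "continuous_map (C_inv_compact_open G \<phi> TX) (C_inv_compact_open G \<phi> Y) T"
  unfolding C_inv_compact_open_def
proof (rule continuous_map_compact_open_Lipschitz[OF compact_space_TX, where c = "1 + c"])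
  fix p q e w
  assume p: "p \<in> C_inv G \<phi> TX" and q: "q \<in> C_inv G \<phi> TX" and w: "w \<in> topspace (prod_topology Y Y)"
    and le: "\<And>z. z \<in> topspace (prod_topology TX TX) \<Longrightarrow> \<bar>q z - p z\<bar> \<le> e"
  obtain y z where yz: "w = (y, z)" "y \<in> E" "z \<in> E" using w by auto
  \<comment> \<open>Linearity reduces the Lipschitz estimate to the sup bound for the difference
    \<open>q - p\<close>.\<close>
  have "\<bar>T (\<lambda>u\<in>X \<times> X. 1 * q u + (- 1) * p u) (y, z)\<bar> \<le> (1 + c) * e"
    by (rule T_abs_le[OF C_inv_combination[OF q p] _ yz(2,3)]) (use le in \<open>auto simp: topspace_Int_X\<close>)
  then show "\<bar>T q w - T p w\<bar> \<le> (1 + c) * e"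
    unfolding T_combination[OF q p yz(2,3)] yz(1) by simp
qed (use c_nonneg T_in_C_inv in \<open>auto simp: C_inv_def\<close>)

lemma T_op_norm: "op_norm G \<phi> TX Y T \<le> ereal (1 + c)"
  unfolding op_norm_def topspace_TX
proof (rule Inf_lower, intro CollectI exI conjI ballI, rule refl)
  fix p assume p: "p \<in> C_inv G \<phi> TX"
  let ?N = "SUP u\<in>X \<times> X. ennreal \<bar>p u\<bar>"
  obtain B0 where B0: "\<And>u. u \<in> X \<times> X \<Longrightarrow> \<bar>p u\<bar> \<le> B0" using C_inv_bounded[OF p] by blast
  \<comment> \<open>Compactness of \<open>X\<close> makes the sup norm finite, so it is a real
    \<open>B\<close> to which \<open>T_abs_le\<close> applies.\<close>
  have "?N \<le> ennreal B0" using B0 by (intro SUP_least ennreal_leI)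
  then obtain B where B: "B \<ge> 0" "?N = ennreal B" by (cases ?N) (auto simp: top_unique)
  have "\<bar>p u\<bar> \<le> B" if "u \<in> X \<times> X" for u
    using SUP_upper[OF that, of "\<lambda>u. ennreal \<bar>p u\<bar>"] B by simp
  then have "\<bar>T p u\<bar> \<le> (1 + c) * B" if "u \<in> E \<times> E" for u
    using T_abs_le[OF p, of B] that by auto
  then have "(SUP u\<in>E \<times> E. ennreal \<bar>T p u\<bar>) \<le> ennreal ((1 + c) * B)"
    by (intro SUP_least ennreal_leI)
  then have "sup_norm (E \<times> E) (T p) \<le> enn2ereal (ennreal ((1 + c) * B))"
    unfolding sup_norm_def by (simp only: less_eq_ennreal.rep_eq)
  also have "\<dots> = ereal (1 + c) * sup_norm (X \<times> X) p"
    unfolding sup_norm_def B(2) using B(1) c_nonneg by (simp add: enn2ereal_ennreal)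
  finally show "sup_norm (E \<times> E) (T p) \<le> ereal (1 + c) * sup_norm (X \<times> X) p" .
qed

section \<open>Preservation of pseudometrics, metrics and admissible metrics\<close>

lemma T_pseudometric:
  assumes p: "p \<in> C_inv G \<phi> TX" and pm: "pseudometric_on X p"
  shows "pseudometric_on E (T p)"
proof -
  have pab: "0 \<le> p (a, b)" using pm a b by (simp add: pseudometric_on_def)
  note S = S_pseudometric[OF p pm, unfolded pseudometric_on_def fst_conv snd_conv]
  note R = \<rho>_pseudometric[unfolded pseudometric_on_def fst_conv snd_conv]
  have "T p (x, z) \<le> T p (x, y) + T p (y, z)" if "x \<in> E" "y \<in> E" "z \<in> E" for x y z
  proof -
    have "p (a, b) * \<rho> x z \<le> p (a, b) * (\<rho> x y + \<rho> y z)"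
      using R that pab by (intro mult_left_mono) auto
    moreover have "S p x z \<le> S p x y + S p y z" using S that by simp
    ultimately show ?thesis using that by (simp add: T_apply distrib_left)
  qed
  then show ?thesis
    using S R pab unfolding pseudometric_on_def by (simp add: T_apply)
qed

text \<open>\<rho> separates distinct points unless both lie in \<open>X\<close>, and there
  \<open>T p\<close> agrees with the metric \<open>p\<close>. The first bound is also the link
  between \<open>T p\<close> and \<open>D\<close> in the proof of domination.\<close>

lemma T_eq_0:
  assumes p: "p \<in> C_inv G \<phi> TX" and m: "metric_on X p" and yz: "y \<in> E" "z \<in> E"
  shows "p (a, b) * \<rho> y z \<le> T p (y, z)" "T p (y, z) = 0 \<Longrightarrow> y = z"
proof -
  have pm: "pseudometric_on X p" using m by (simp add: metric_on_def)
  have "0 \<le> S p y z" using S_pseudometric[OF p pm] yz by (simp add: pseudometric_on_def)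
  then show *: "p (a, b) * \<rho> y z \<le> T p (y, z)" by (simp add: T_apply yz)
  have pab: "0 < p (a, b)"
    using m a b a_neq_b by (auto simp: metric_on_def pseudometric_on_def less_le)
  assume 0: "T p (y, z) = 0"
  then have "p (a, b) * \<rho> y z \<le> 0" using * by simp
  then have "\<rho> y z = 0" using pab \<rho>_nonneg[of y z] by (simp add: mult_le_0_iff)
  then consider "y = z" | "y \<in> X" "z \<in> X" using \<rho>_eq_0[OF yz] by blast
  then show "y = z"
  proof cases
    case 2
    then have "p (y, z) = 0" using 0 T_X[OF p] by simp
    then show ?thesis using m 2 by (simp add: metric_on_def)
  qed
qed

lemma T_metric:
  assumes p: "p \<in> C_inv G \<phi> TX" and m: "metric_on X p"
  shows "metric_on E (T p)"
  using T_pseudometric[OF p] T_eq_0(2)[OF p m] m by (auto simp: metric_on_def)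

text \<open>Near a point of \<^term>\<open>X\<close> the summand \<^term>\<open>\<rho>\<close> controls only the distance from \<^term>\<open>X\<close>; the rest
  follows from compactness, as a continuous metric on \<^term>\<open>X\<close> is automatically admissible.\<close>

lemma T_dominating:
  assumes p: "p \<in> C_inv G \<phi> TX" and m: "metric_on X p"
  shows "dominating Y (T p)"
  unfolding dominating_def
proof (intro allI impI, elim conjE)
  fix z O' assume O': "openin Y O'" and z: "z \<in> O'"
  have zE: "z \<in> E" using O' z openin_subset by blast
  have pab: "0 < p (a, b)"
    using m a b a_neq_b by (auto simp: metric_on_def pseudometric_on_def less_le)
  have \<rho>_less: "\<rho> z y < s" if "y \<in> E" "T p (z, y) < p (a, b) * s" for y s
  proof -
    have "p (a, b) * \<rho> z y < p (a, b) * s" using T_eq_0(1)[OF p m zE that(1)] that(2) by linarith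
    then show ?thesis using pab by (simp add: mult_less_cancel_left_pos)
  qed
  show "\<exists>e>0. {y \<in> E. T p (z, y) < e} \<subseteq> O'"
  proof (cases "z \<in> X")
    case False
    have dz: "0 < \<delta> z" using \<delta>_nonneg[of z] \<delta>_eq_0_iff[OF zE] False by linarith
    obtain s where s: "s > 0" "Y.mball z s \<subseteq> O'"
      using O' z by (metis Y.openin_mtopology mtopology_D)
    \<comment> \<open>Staying below \<delta> at \<open>z\<close> rules out the detour through
      \<open>X\<close>, so \<rho> equals \<open>D\<close> here.\<close>
    have "y \<in> O'" if y: "y \<in> E" "T p (z, y) < p (a, b) * min s (\<delta> z)" for y
    proof -
      have "\<rho> z y < min s (\<delta> z)" using \<rho>_less[OF y] .
      then have "D z y < s" using \<delta>_nonneg[of y] by (auto simp: \<rho>_def min_def split: if_splits)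
      then show ?thesis using s y zE by auto
    qed
    then show ?thesis using pab s dz by (intro exI[of _ "p (a, b) * min s (\<delta> z)"]) auto
  next
    case True
    have c: "continuous_map Y euclideanreal (\<lambda>y. T p (z, y))"
    proof -
      have "continuous_map Y (prod_topology Y Y) (\<lambda>y. (z, y))" using zE by (simp add: continuous_map_paired)
      moreover have "continuous_map (prod_topology Y Y) euclideanreal (T p)"
        using T_in_C_inv[OF p] by (simp add: C_inv_def cont_fun_def)
      ultimately have "continuous_map Y euclideanreal (T p \<circ> (\<lambda>y. (z, y)))" by (rule continuous_map_compose)
      then show ?thesis by (simp add: o_def)
    qed
    \<comment> \<open>On the compact set \<open>X - O'\<close> the positive continuous function
      \<open>T p (z, _)\<close> attains a positive minimum; half of it is a strict lower
      bound.\<close>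
    obtain e0 where e0: "e0 > 0" "\<And>x. x \<in> X - O' \<Longrightarrow> e0 < T p (z, x)"
    proof (cases "X - O' = {}")
      case True then show ?thesis using that[of 1] by auto
    next
      case False
      have "compactin Y (X \<inter> (E - O'))" using compact_X O' by (intro compact_Int_closedin) auto
      moreover have "X \<inter> (E - O') = X - O'" using X_subset by auto
      ultimately have "compact ((\<lambda>y. T p (z, y)) ` (X - O'))"
        using image_compactin[OF _ c, of "X - O'"] by simp
      then obtain x where x: "x \<in> X - O'" "\<And>y. y \<in> X - O' \<Longrightarrow> T p (z, x) \<le> T p (z, y)"
        using compact_attains_inf[of "(\<lambda>y. T p (z, y)) ` (X - O')"] False by auto
      have "x \<noteq> z" "x \<in> E" using x z X_subset by auto
      then have "T p (z, x) > 0"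
        using T_metric[OF p m] zE by (auto simp: metric_on_def pseudometric_on_def less_le)
      then show ?thesis using that[of "T p (z, x) / 2"] x by force
    qed
    \<comment> \<open>\<open>O' \<union> V\<close> is open and contains \<open>X\<close>. A Lebesgue
      number \<open>s\<close> puts every point within \<open>s\<close> of \<open>X\<close> into it,
      and the bound \<open>e0\<close> then excludes \<open>V\<close>.\<close>
    define V where "V = {y \<in> E. T p (z, y) \<in> {e0<..}}"
    have V: "openin Y V" unfolding V_def by (rule openin_continuous_map_preimage[OF c]) simp
    have "X \<subseteq> \<Union>{O' \<union> V}" using e0 X_subset by (auto simp: V_def)
    moreover have "openin Y.mtopology W" if "W \<in> {O' \<union> V}" for W using that V O' by (auto simp: mtopology_D)
    ultimately obtain s where s: "s > 0" "\<And>x. x \<in> X \<Longrightarrow> Y.mball x s \<subseteq> O' \<union> V"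
      using Y.lebesgue_number[of X "{O' \<union> V}"] compact_X by (auto simp: mtopology_D)
    have "y \<in> O'" if y: "y \<in> E" "T p (z, y) < min e0 (p (a, b) * s)" for y
    proof -
      have "\<rho> z y < s" using \<rho>_less[OF y(1)] y(2) by simp
      moreover have "\<delta> y \<le> D z y" using Y.mdist_set_le[OF True, of y] by (simp add: Y.commute)
      \<comment> \<open>Since \<open>z\<close> lies in \<open>X\<close>, the detour costs exactly
        \<delta> at \<open>y\<close>, and the direct way costs at least as much.\<close>
      ultimately have "\<delta> y < s" using \<delta>_eq_0_iff[OF zE] True by (auto simp: \<rho>_def min_def split: if_splits)
      then obtain x where x: "x \<in> X" "D y x < s"
        using cInf_lessD[of "D y ` X" s] X_nonempty by (auto simp: Y.mdist_set_def)
      then have "y \<in> Y.mball x s" using y X_subset by (auto simp: Y.commute)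
      then have "y \<in> O' \<union> V" using s(2)[OF x(1)] by blast
      then show ?thesis using y by (auto simp: V_def)
    qed
    then show ?thesis using e0 s pab by (intro exI[of _ "min e0 (p (a, b) * s)"]) auto
  qed
qed

text \<open>For finite \<open>G\<close> each value of \<open>T p\<close> is a fixed finite linear
  combination of values of \<open>p\<close>: a finite sum over the group of the combinations from
  \<open>H_finite_combination\<close>, plus a multiple of \<open>p (a, b)\<close>.\<close>

lemma T_pointwise_continuous:
  assumes fin: "finite (carrier G)"
  shows "continuous_map (C_inv_pointwise G \<phi> TX) (C_inv_pointwise G \<phi> Y) T"
proof -
  let ?P = "C_inv_pointwise G \<phi> TX"
  have eval: "continuous_map ?P euclideanreal (\<lambda>p. p u)" if "u \<in> X \<times> X" for u
    unfolding C_inv_pointwise_def topspace_TX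
    by (rule continuous_map_from_subtopology[OF continuous_map_product_projection[OF that]])
  have Hc: "continuous_map ?P euclideanreal (\<lambda>p. H p y z)" if yz: "y \<in> E" "z \<in> E" for y z
  proof -
    obtain F w where F: "finite F" "F \<subseteq> X \<times> X" "\<And>p. H p y z = (\<Sum>u\<in>F. w u * p u)"
      using H_finite_combination[OF yz] by auto
    show ?thesis
      unfolding F(3) using F(1,2) by (intro continuous_intros eval) auto
  qed
  have "continuous_map ?P euclideanreal (\<lambda>p. T p u)" if u: "u \<in> E \<times> E" for u
  proof -
    have "continuous_map ?P euclideanreal
        (\<lambda>p. (\<Sum>g\<in>carrier G. H p (\<phi> g (fst u)) (\<phi> g (snd u))) / card (carrier G) + p (a, b) * \<rho> (fst u) (snd u))"
      using u a b fin one_closed by (intro continuous_intros Hc eval) (auto simp: action_closed)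
    moreover have "T p u = (\<Sum>g\<in>carrier G. H p (\<phi> g (fst u)) (\<phi> g (snd u))) / card (carrier G) +
        p (a, b) * \<rho> (fst u) (snd u)" for p
      using u fun_cong[OF M_finite[OF fin]] by (simp add: T_def S_def)
    ultimately show ?thesis by simp
  qed
  moreover have "T p \<in> extensional (E \<times> E)" for p by (simp add: T_def)
  ultimately have "continuous_map ?P (product_topology (\<lambda>_. euclideanreal) (E \<times> E)) T"
    by (simp add: continuous_map_componentwise image_subset_iff)
  moreover have "topspace ?P \<subseteq> C_inv G \<phi> TX" by (auto simp: C_inv_pointwise_def)
  ultimately show ?thesis
    unfolding C_inv_pointwise_def[of G \<phi> Y] using T_in_C_inv by (auto simp: continuous_map_in_subtopology)
qed

end

theorem theorem4p2:
  fixes G :: "('g, 'm) monoid_scheme" and TG :: "'g topology"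
    and Y :: "'y topology" and \<phi> :: "'g \<Rightarrow> 'y \<Rightarrow> 'y"
    and X :: "'y set" and \<epsilon> :: real
  defines "TX \<equiv> subtopology Y X"
  assumes "compact_topological_group G TG"
    and "G_space G TG Y \<phi>"
    and "metrizable_space Y"
    and "compactin Y X"
    and "invariant_subset G \<phi> X"
    and "\<exists>x\<in>X. \<exists>y\<in>X. x \<noteq> y"
    and "\<epsilon> > 0"
  shows "\<exists>T :: ('y \<times> 'y \<Rightarrow> real) \<Rightarrow> 'y \<times> 'y \<Rightarrow> real.
      extension_operator G \<phi> TX Y T \<and>
      linear_operator G \<phi> TX Y T \<and>
      positive_operator G \<phi> TX Y T \<and>
      continuous_map (C_inv_compact_open G \<phi> TX) (C_inv_compact_open G \<phi> Y) T \<and>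
      op_norm G \<phi> TX Y T < ereal (1 + \<epsilon>) \<and>
      T ` invariant_pseudometrics G \<phi> TX \<subseteq> invariant_pseudometrics G \<phi> Y \<and>
      T ` invariant_metrics G \<phi> TX \<subseteq> invariant_metrics G \<phi> Y \<and>
      T ` admissible_invariant_metrics G \<phi> TX \<subseteq> admissible_invariant_metrics G \<phi> Y \<and>
      (finite (carrier G) \<longrightarrow>
        continuous_map (C_inv_pointwise G \<phi> TX) (C_inv_pointwise G \<phi> Y) T)"
proof -
  interpret compact_topological_group G TG by fact
  obtain D where "Metric_space (topspace Y) D" and mt: "Metric_space.mtopology (topspace Y) D = Y"
    and D_le: "\<And>y z. D y z \<le> \<epsilon>/2"
    and D_inv: "\<And>g y z. g \<in> carrier G \<Longrightarrow> y \<in> topspace Y \<Longrightarrow> z \<in> topspace Y \<Longrightarrow> D (\<phi> g y) (\<phi> g z) = D y z"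
    using invariant_metric_exists[OF assms(2,3,4), of "\<epsilon>/2"] \<open>\<epsilon> > 0\<close> by auto
  then interpret D: Metric_space "topspace Y" D by blast
  obtain a b where ab: "a \<in> X" "b \<in> X" "a \<noteq> b" using assms by blast
  have "compactin D.mtopology X" "X \<noteq> {}" using assms(5) ab by (auto simp: mt)
  from D.random_retraction[OF this, unfolded mt] obtain r :: "real \<Rightarrow> 'y \<Rightarrow> 'y" where
    r: "(\<forall>t y. r t y \<in> X) \<and> (\<forall>t. \<forall>x\<in>X. r t x = x) \<and>
    (\<forall>y\<in>topspace Y. simple_function borel (\<lambda>t. r t y)) \<and>
    (\<forall>\<sigma> y. limitin Y \<sigma> y sequentially \<longrightarrow> range \<sigma> \<subseteq> topspace Y \<longrightarrow>
      (AE t in lborel. limitin Y (\<lambda>n. r t (\<sigma> n)) (r t y) sequentially))" ..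
  \<comment> \<open>One operator must have all the properties, so the mean is fixed here: the plain
    average whenever the group is finite.\<close>
  obtain M where M: "invariant_mean M"
    "finite (carrier G) \<Longrightarrow> M = (\<lambda>f. (\<Sum>x\<in>carrier G. f x) / card (carrier G))"
  proof (cases "finite (carrier G)")
    case True
    show ?thesis using that[OF invariant_mean_finite[OF True]] by simp
  next
    case False
    then show ?thesis using that invariant_mean_exists by blast
  qed
  interpret equivariant_extension G TG Y \<phi> D X "\<epsilon>/2" M r a b
    by (intro equivariant_extension.intro equivariant_extension_axioms.intro assms(2,3,5,6)
        D.Metric_space_axioms mt D_le D_inv ab M) (use r in simp_all)
  have norm: "op_norm G \<phi> TX Y T < ereal (1 + \<epsilon>)"
    using order_le_less_trans[OF T_op_norm, of "ereal (1 + \<epsilon>)"] \<open>\<epsilon> > 0\<close> by (simp add: TX_def)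
  have tX: "topspace TX = X" using topspace_TX by (simp add: TX_def)
  have "T ` invariant_pseudometrics G \<phi> TX \<subseteq> invariant_pseudometrics G \<phi> Y"
    using T_in_C_inv T_pseudometric unfolding invariant_pseudometrics_def tX by (auto simp: TX_def)
  moreover have "T ` invariant_metrics G \<phi> TX \<subseteq> invariant_metrics G \<phi> Y"
    using T_in_C_inv T_metric unfolding invariant_metrics_def tX by (auto simp: TX_def)
  moreover have "T ` admissible_invariant_metrics G \<phi> TX \<subseteq> admissible_invariant_metrics G \<phi> Y"
    using T_in_C_inv T_metric T_dominating unfolding admissible_invariant_metrics_def tX by (auto simp: TX_def)
  ultimately show ?thesis
    using T_extension T_linear T_positive T_continuous T_pointwise_continuous norm
    unfolding TX_def by blast
qed

end
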